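(* Let $n\ge1$ and let $M_\#\in\mathbb{C}^{n\times n}$ be a random matrix whose entries have real and imaginary parts drawn independently from the standard normal distribution (that is, the $2n^2$ real and imaginary parts of the entries are independent $N(0,1)$ random variables). Then the probability that $M_\#$ is condiagonalizable is $2^{-n(n-1)/2}$.
   Context: A matrix $M_\#\in\mathbb{C}^{n\times n}$ is called condiagonalizable if there exist an invertible matrix $X\in\mathbb{C}^{n\times n}$ and a diagonal matrix $\Lambda_\#\in\mathbb{C}^{n\times n}$ such that $M_\#=X\Lambda_\#\overline{X^{-1}}$, where the bar denotes entrywise complex conjugation. *)

theory Defs
  imports "HOL-Probability.Probability"
begin

definition diagonal_matrix :: "'a::zero^'n^'n \<Rightarrow> bool" where
  "diagonal_matrix D \<longleftrightarrow> (\<forall>i j. i \<noteq> j \<longrightarrow> D $ i $ j = 0)"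

definition condiagonalizable :: "complex^'n^'n \<Rightarrow> bool" where
  "condiagonalizable A \<longleftrightarrow>
     (\<exists>(X :: complex^'n^'n) (D :: complex^'n^'n).
        invertible X \<and> diagonal_matrix D \<and> A = X ** D ** map_matrix cnj (matrix_inv X))"

end

theory Submission imports Defs
begin

text \<open>
  Condiagonalizable matrices with distinct positive coneigenvalues are exactly the matrices
  \<open>U (\<Sigma> + R) U\<^sup>T\<close> with \<open>U\<close> unitary, \<open>\<Sigma>\<close> positive diagonal with distinct entries and \<open>R\<close> strictly
  upper triangular. By Takagi's theorem almost every complex symmetric matrix is \<open>S = U \<Sigma> U\<^sup>T\<close>
  with the same data \<open>(U, \<Sigma>)\<close>. In the moving frame given by \<open>U\<close>, the derivatives of
  \<open>(U, \<Sigma>, R) \<mapsto> U (\<Sigma> + R) U\<^sup>T\<close> and of \<open>(U, \<Sigma>, R) \<mapsto> (U \<Sigma> U\<^sup>T, R)\<close> differ by a block triangular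
  perturbation with unit diagonal, so both maps have the same Jacobian, and both preserve the
  Frobenius norm \<open>|\<Sigma>|\<^sup>2 + |R|\<^sup>2\<close> of the data. The probability is therefore the Gaussian integral
  over all pairs \<open>(S, R)\<close>. An entry of \<open>S\<close> off the diagonal is counted twice in \<open>|S|\<^sup>2\<close>, which costs
  a factor \<open>1/2\<close> for each of the \<open>n(n-1)/2\<close> complex entries below the diagonal. Neither the
  Jacobian itself nor a Selberg integral has to be evaluated.
\<close>

section \<open>Unitary and triangular matrices\<close>

text \<open>Not every matrix has a con-Schur form with nonnegative diagonal, whereas every symmetric
  matrix has a diagonal one. Running both factorizations over one parameter domain therefore trades
  an unknown volume for the whole space. The unitary factor needs a chart. The Cayley transform is a
  global one, except that it misses the unitary matrices with eigenvalue -1. This is harmless: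
  \<open>U\<close> matters only up to the signs of its columns, and some choice of signs always
  avoids that eigenvalue. Several choices may do so, hence the fundamental domain, on which both
  maps are injective. Matrices with a vanishing or repeated coneigenvalue need no description of
  their own. The Jacobians vanish at their parameters, so Sard's theorem makes the corresponding
  images null. The index type carries no order; the injective numbering \<open>rk\<close>, whose
  values may have gaps, supplies one for everything triangular or sorted.\<close>

abbreviation rk :: "'n::finite \<Rightarrow> nat" where "rk \<equiv> to_nat"

text \<open>
  A term of the Leibniz formula that does not vanish satisfies \<open>w (p i) \<le> w i\<close> for all \<open>i\<close>, hence
  \<open>w (p i) = w i\<close>, since both sides have the same sum.
\<close>

lemma det_block_triangular_eq:
  fixes A B :: "'a::comm_ring_1^'n^'n" and w :: "'n \<Rightarrow> nat"
  assumes "\<And>i j. w i < w j \<Longrightarrow> A $ i $ j = 0" "\<And>i j. w i < w j \<Longrightarrow> B $ i $ j = 0"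
    and "\<And>i j. w i = w j \<Longrightarrow> A $ i $ j = B $ i $ j"
  shows "det A = det B"
proof -
  have "(\<Prod>i\<in>UNIV. A $ i $ p i) = (\<Prod>i\<in>UNIV. B $ i $ p i)" if p: "p permutes UNIV" for p
  proof (cases "\<exists>i. w i < w (p i)")
    case True
    then obtain i where i: "w i < w (p i)" ..
    have "(\<Prod>i\<in>UNIV. A $ i $ p i) = 0" "(\<Prod>i\<in>UNIV. B $ i $ p i) = 0"
      using assms(1,2)[OF i] by (auto intro!: prod_zero)
    then show ?thesis by simp
  next
    case False
    have "(\<Sum>i\<in>UNIV. w (p i)) = (\<Sum>i\<in>UNIV. w i)"
      using p by (metis permutes_imp_bij sum.reindex_bij_betw)
    then have "(\<Sum>i\<in>UNIV. w i - w (p i)) = 0"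
      using False by (subst sum_subtractf_nat) (auto simp: not_less)
    then have "w i = w (p i)" for i
      using False by (auto simp: not_less intro: antisym)
    then show ?thesis
      using assms(3) by (intro prod.cong) auto
  qed
  then show ?thesis unfolding det_def by (auto intro!: sum.cong)
qed

section \<open>Conjugate transposes and unitary matrices\<close>

definition adj :: "complex^'n^'m \<Rightarrow> complex^'m^'n" where
  "adj A = transpose (map_matrix cnj A)"

lemma adj_component [simp]: "adj A $ i $ j = cnj (A $ j $ i)"
  by (simp add: adj_def transpose_def map_matrix_def)

definition conj_mat :: "complex^'n^'m \<Rightarrow> complex^'n^'m" where
  "conj_mat A = map_matrix cnj A"

lemma conj_mat_component [simp]: "conj_mat A $ i $ j = cnj (A $ i $ j)"
  by (simp add: conj_mat_def map_matrix_def)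

lemma transpose_component [simp]: "transpose A $ i $ j = A $ j $ i"
  by (simp add: transpose_def)

lemma matrix_mult_component: "(A ** B) $ i $ j = (\<Sum>k\<in>UNIV. A $ i $ k * B $ k $ j)"
  by (simp add: matrix_matrix_mult_def)

lemma conj_mat_mult: "conj_mat (A ** B) = conj_mat A ** conj_mat B"
  by (simp add: vec_eq_iff matrix_mult_component)

lemma conj_mat_mat1 [simp]: "conj_mat (mat 1) = mat 1"
  by (simp add: vec_eq_iff mat_def)

lemma adj_mult: "adj (A ** B) = adj B ** adj A"
  by (simp add: vec_eq_iff matrix_mult_component mult.commute)

lemma adj_adj [simp]: "adj (adj A) = A"
  by (simp add: vec_eq_iff)

lemma adj_mat1 [simp]: "adj (mat 1) = mat 1"
  by (simp add: vec_eq_iff mat_def)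

lemma adj_conj_mat: "adj (conj_mat A) = transpose A" "conj_mat (adj A) = transpose A"
  "conj_mat (transpose A) = adj A" "transpose (conj_mat A) = adj A" "transpose (adj A) = conj_mat A"
  "adj (transpose A) = conj_mat A"
  by (simp_all add: vec_eq_iff)

lemma transpose_mult: "transpose (A ** B) = transpose B ** transpose (A :: complex^'n^'n)"
  by (rule matrix_transpose_mul)

definition unitary :: "complex^'n^'n \<Rightarrow> bool" where
  "unitary U \<longleftrightarrow> adj U ** U = mat 1"

lemma unitaryD:
  assumes "unitary U"
  shows "adj U ** U = mat 1" "U ** adj U = mat 1" "transpose U ** conj_mat U = mat 1"
    "conj_mat U ** transpose U = mat 1"
proof -
  show 1: "adj U ** U = mat 1" using assms by (simp add: unitary_def)
  then show 2: "U ** adj U = mat 1" by (simp add: matrix_left_right_inverse)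
  show "transpose U ** conj_mat U = mat 1" "conj_mat U ** transpose U = mat 1"
    using arg_cong[OF 1, of conj_mat] arg_cong[OF 2, of conj_mat]
        by (simp_all add: conj_mat_mult adj_conj_mat)
qed

lemma unitary_mult: "unitary U \<Longrightarrow> unitary V \<Longrightarrow> unitary (U ** V)"
  unfolding unitary_def adj_mult
  by (metis matrix_mul_assoc matrix_mul_lid)

lemma unitary_adj: "unitary U \<Longrightarrow> unitary (adj U)"
  by (simp add: unitary_def unitaryD)

lemma unitary_invertible: "unitary U \<Longrightarrow> invertible U"
  using unitaryD invertible_def by blast

lemma unitary_mat1 [simp]: "unitary (mat 1)" by (simp add: unitary_def)

lemma matrix_inv_mult:
  assumes "invertible A"
  shows "A ** matrix_inv A = mat 1" "matrix_inv A ** A = mat 1"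
  using someI_ex[of "\<lambda>B. A ** B = mat 1 \<and> B ** A = mat 1"] assms
  unfolding matrix_inv_def invertible_def by auto

text \<open>The columns of \<open>X\<close> become coneigenvectors of \<open>A\<close>, and without
  the inverse a unitary change of frame can simply be multiplied in.\<close>

lemma condiagonalizable_iff:
  fixes A :: "complex^'n^'n"
  shows "condiagonalizable A \<longleftrightarrow>
    (\<exists>(X :: complex^'n^'n) (D :: complex^'n^'n).
       invertible X \<and> diagonal_matrix D \<and> A ** conj_mat X = X ** D)"
proof -
  have *: "A = X ** D ** map_matrix cnj (matrix_inv X) \<longleftrightarrow> A ** conj_mat X = X ** D"
    if X: "invertible X" for X D :: "complex^'n^'n"
  proof -
    have 1: "conj_mat (matrix_inv X) ** conj_mat X =
        mat 1" "conj_mat X ** conj_mat (matrix_inv X) = mat 1"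
      using X by (simp_all flip: conj_mat_mult add: matrix_inv_mult)
    show ?thesis unfolding conj_mat_def[symmetric]
      using 1 by (metis matrix_mul_assoc matrix_mul_rid)
  qed
  show ?thesis unfolding condiagonalizable_def by (simp add: * cong: conj_cong)
qed

section \<open>Gram-Schmidt and QR factorization in the order of \<open>rk\<close>\<close>

definition upper :: "complex^'n^'n \<Rightarrow> bool" where
  "upper T \<longleftrightarrow> (\<forall>i j. rk j < rk i \<longrightarrow> T $ i $ j = 0)"

definition cdot :: "complex^'n \<Rightarrow> complex^'n \<Rightarrow> complex" where
  "cdot u v = (\<Sum>k\<in>UNIV. cnj (u $ k) * v $ k)"

lemma cdot_add_right: "cdot u (v + w) = cdot u v + cdot u w"
  by (simp add: cdot_def algebra_simps sum.distrib)
lemma cdot_diff_right: "cdot u (v - w) = cdot u v - cdot u w"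
  by (simp add: cdot_def algebra_simps sum_subtractf)
lemma cdot_scale_right: "cdot u (c *s v) = c * cdot u v"
  by (simp add: cdot_def algebra_simps sum_distrib_left)
lemma cdot_scale_left: "cdot (c *s u) v = cnj c * cdot u v"
  by (simp add: cdot_def algebra_simps sum_distrib_left)
lemma cdot_sum_right: "cdot u (\<Sum>k\<in>S. f k) = (\<Sum>k\<in>S. cdot u (f k))"
  by (induction S rule: infinite_finite_induct) (auto simp: cdot_add_right, simp_all add: cdot_def)
lemma cdot_cnj: "cnj (cdot u v) = cdot v u"
  by (simp add: cdot_def mult.commute)
lemma cdot_self: "cdot u u = complex_of_real ((norm u)\<^sup>2)"
proof -
  have "cdot u u = (\<Sum>k\<in>UNIV. complex_of_real ((norm (u $ k))\<^sup>2))"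
    unfolding cdot_def by (intro sum.cong refl) (metis complex_norm_square mult.commute)
  also have "\<dots> = complex_of_real ((norm u)\<^sup>2)"
    unfolding norm_vec_def L2_set_def by (simp add: sum_nonneg)
  finally show ?thesis .
qed

text \<open>Induction over initial segments. Carrying the span of each \<open>c j\<close> along
  keeps the next residual \<open>y\<close> nonzero; the coefficient of \<open>x j\<close> on its own
  basis vector is \<open>norm y\<close>, hence real.\<close>

lemma gram_schmidt:
  fixes x :: "'n::finite \<Rightarrow> complex^'n"
  assumes "\<And>j. x j \<notin> vec.span (x ` {i. rk i < rk j})"
  shows "\<exists>c. (\<forall>i j. rk i < m \<longrightarrow> rk j < m \<longrightarrow> cdot (c i) (c j) = (if i = j then 1 else 0)) \<and>
    (\<forall>j. rk j < m \<longrightarrow> x j = (\<Sum>k | rk k \<le> rk j. cdot (c k) (x j) *s c k) \<and>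
      cdot (c j) (x j) \<noteq> 0 \<and> cdot (c j) (x j) \<in> \<real> \<and>
      c j \<in> vec.span (x ` {i. rk i \<le> rk j}))"
proof (induction m)
  case 0
  then show ?case by auto
next
  case (Suc m)
  from Suc.IH obtain c where c: "\<And>i j. rk i < m \<Longrightarrow> rk j < m \<Longrightarrow> cdot (c i) (c j) = (if i =
      j then 1 else 0)"
    and cx: "\<And>j. rk j < m \<Longrightarrow> x j = (\<Sum>k | rk k \<le> rk j. cdot (c k) (x j) *s c k)"
    and cn: "\<And>j. rk j < m \<Longrightarrow> cdot (c j) (x j) \<noteq> 0 \<and> cdot (c j) (x j) \<in> \<real>"
    and cs: "\<And>j. rk j < m \<Longrightarrow> c j \<in> vec.span (x ` {i. rk i \<le> rk j})"
    by (elim exE conjE) blast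
  show ?case
  \<comment> \<open>The values of \<open>rk\<close> may have gaps or be exhausted; such a stage adds
    no vector.\<close>
  proof (cases "\<exists>j::'n. rk j = m")
    case False
    then have "rk j < Suc m \<longleftrightarrow> rk j < m" for j :: 'n by (metis less_Suc_eq)
    then show ?thesis using c cx cn cs by (intro exI[of _ c]) auto
  next
    case True
    then obtain j :: 'n where j: "rk j = m" by auto
    define p where "p = (\<Sum>k | rk k < m. cdot (c k) (x j) *s c k)"
    define y where "y = x j - p"
    have ps: "p \<in> vec.span (x ` {i. rk i < rk j})"
      unfolding p_def
    proof (intro vec.span_sum vec.span_scale)
      fix k assume "k \<in> {k::'n. rk k < m}"
      then have k: "rk k < m" by simp
      then have "x ` {i. rk i \<le> rk k} \<subseteq> x ` {i. rk i < rk j}" using j by auto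
      then show "c k \<in> vec.span (x ` {i. rk i < rk j})" using cs[OF k] vec.span_mono by blast
    qed
    then have y0: "y \<noteq> 0" using assms[of j] by (auto simp: y_def)
    define c' where "c' = c(j := complex_of_real (1 / norm y) *s y)"
    have c'k: "c' k = c k" if "rk k < m" for k using that j by (auto simp: c'_def)
    have orth: "cdot (c k) y = 0" if k: "rk k < m" for k
    proof -
      have "cdot (c k) p = (\<Sum>l | rk l < m. cdot (c l) (x j) * (if k = l then 1 else 0))"
        unfolding p_def cdot_sum_right cdot_scale_right using c[OF k] by (intro sum.cong) auto
      also have "\<dots> = cdot (c k) (x j)"
        using k by (simp add: sum.delta if_distrib cong: if_cong)
      finally show ?thesis by (simp add: y_def cdot_diff_right)
    qed
    then have orth': "cdot y (c k) = 0" if k: "rk k < m" for k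
      using cdot_cnj[of "c k" y] that by simp
    have orthp: "cdot y p = 0"
      unfolding p_def cdot_sum_right cdot_scale_right using orth' by simp
    have yx: "cdot y (x j) = cdot y y"
      using orthp by (simp add: y_def cdot_diff_right)
    have hj: "cdot (c' j) (x j) = complex_of_real (norm y)"
      using y0 by (simp add: c'_def cdot_scale_left yx cdot_self power2_eq_square)
    have eq: "{k::'n. rk k \<le> rk j} = insert j {k. rk k < m}"
      using j by (auto simp: le_less)
    show ?thesis
    proof (intro exI[of _ c'] conjI allI impI)
      fix i k :: 'n assume "rk i < Suc m" "rk k < Suc m"
      then have "i = j \<or> rk i < m" "k = j \<or> rk k < m" using j by (metis less_Suc_eq to_nat_split)+
      moreover have "cdot (c' j) (c' j) = 1"
        using y0 by (simp add: c'_def cdot_scale_left cdot_scale_right cdot_self[of y] power2_eq_square)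
      ultimately show "cdot (c' i) (c' k) = (if i = k then 1 else 0)"
        using c j by (auto simp: c'_def cdot_scale_left cdot_scale_right orth orth')
    next
      fix k :: 'n assume "rk k < Suc m"
      then have kk: "k = j \<or> rk k < m" using j by (metis less_Suc_eq to_nat_split)
      show "x k = (\<Sum>l | rk l \<le> rk k. cdot (c' l) (x k) *s c' l)"
      proof (cases "k = j")
        case True
        have "(\<Sum>l | rk l \<le> rk j. cdot (c' l) (x j) *s c' l) =
          cdot (c' j) (x j) *s c' j + (\<Sum>l | rk l < m. cdot (c' l) (x j) *s c' l)"
          unfolding eq using j by (subst sum.insert) auto
        also have "(\<Sum>l | rk l < m. cdot (c' l) (x j) *s c' l) = p"
          unfolding p_def by (intro sum.cong) (auto simp: c'k)
        also have "cdot (c' j) (x j) *s c' j = y" unfolding hj using y0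
          by (simp add: c'_def vector_smult_assoc)
        finally show ?thesis using True by (simp add: y_def)
      next
        case False
        then have k: "rk k < m" using kk by auto
        have "(\<Sum>l | rk l \<le> rk k. cdot (c' l) (x k) *s c' l) = (\<Sum>l | rk l \<le>
            rk k. cdot (c l) (x k) *s c l)"
          using k by (intro sum.cong) (auto simp: c'k)
        then show ?thesis using cx[OF k] by simp
      qed
      show "cdot (c' k) (x k) \<noteq> 0" "cdot (c' k) (x k) \<in> \<real>"
        using kk cn c'k hj y0 by auto
      show "c' k \<in> vec.span (x ` {i. rk i \<le> rk k})"
      proof (cases "k = j")
        case True
        have "p \<in> vec.span (x ` {i. rk i \<le> rk j})" using ps vec.span_mono
          by (metis (mono_tags, lifting) Collect_mono image_mono less_imp_le subsetD)
        moreover have "x j \<in> vec.span (x ` {i. rk i \<le> rk j})" by (intro vec.span_base) auto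
        ultimately show ?thesis unfolding True c'_def y_def
          by (simp add: vec.span_diff vec.span_scale)
      qed (use kk cs c'k in auto)
    qed
  qed
qed

text \<open>Otherwise the columns are dependent and the determinant is zero. Since
  \<open>columns X\<close> is a set, the columns must be distinct for the removal of
  \<open>column j X\<close> to take away that index alone.\<close>

lemma columns_not_in_span:
  fixes X :: "complex^'n^'n"
  assumes "invertible X"
  shows "column j X \<notin> vec.span ((\<lambda>j. column j X) ` {i. rk i < rk j})"
proof
  assume *: "column j X \<in> vec.span ((\<lambda>j. column j X) ` {i. rk i < rk j})"
  have d: "det X \<noteq> 0" using assms by (simp add: invertible_det_nz)
  have ne: "column i X \<noteq> column j X" if "i \<noteq> j" for i
    using d that det_identical_columns[of i j X] by auto
  have "(\<lambda>j. column j X) ` {i. rk i < rk j} \<subseteq> columns X - {column j X}"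
  proof safe
    fix i :: 'n assume i: "rk i < rk j"
    show "column i X \<in> columns X" by (auto simp: columns_def)
    show False if "column i X = column j X" using ne[of i] i that by auto
  qed
  then have "column j X \<in> vec.span (columns X - {column j X})"
    using * vec.span_mono by blast
  moreover have "column j X \<in> columns X" by (auto simp: columns_def)
  ultimately have "vec.dependent (columns X)" unfolding vec.dependent_def by blast
  then have "vec.dependent (rows (transpose X))" by (simp add: rows_transpose)
  then show False using d det_dependent_rows[of "transpose X"] by simp
qed

text \<open>The Gram-Schmidt vectors are the columns of \<open>U\<close>. The diagonal of
  \<open>Q\<close> is kept real and nonzero because in the con-Schur form it meets its own conjugate
  and has to cancel.\<close>

lemma QR_decomposition:
  fixes X :: "complex^'n^'n"
  assumes "invertible X"
  obtains U Q where "unitary U" "upper Q" "X = U ** Q" "\<And>i. Q $ i $ i \<in> \<real>" "\<And>i. Q $ i $ i \<noteq> 0"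
proof -
  let ?x = "\<lambda>j. column j X"
  obtain m where "\<forall>x\<in>range (rk :: 'n \<Rightarrow> nat). x < m"
    using finite_nat_set_iff_bounded[of "range (rk :: 'n \<Rightarrow> nat)"] finite_imageI[OF finite[of UNIV]]
    by meson
  then have m: "rk j < m" for j :: 'n by (meson rangeI)
  from gram_schmidt[of ?x m, OF columns_not_in_span[OF assms]]
  obtain c where c': "\<forall>i j. rk i < m \<longrightarrow> rk j < m \<longrightarrow> cdot (c i) (c j) = (if i = j then 1 else 0)"
    and cx': "\<forall>j. rk j < m \<longrightarrow> ?x j = (\<Sum>k | rk k \<le> rk j. cdot (c k) (?x j) *s c k) \<and>
      cdot (c j) (?x j) \<noteq> 0 \<and> cdot (c j) (?x j) \<in> \<real> \<and>
      c j \<in> vec.span (?x ` {i. rk i \<le> rk j})" by (elim exE conjE)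
  have c: "cdot (c i) (c j) = (if i = j then 1 else 0)" for i j by (rule c'[rule_format, OF m m])
  have cx: "?x j = (\<Sum>k | rk k \<le> rk j. cdot (c k) (?x j) *s c k)"
    and cn: "cdot (c j) (?x j) \<noteq> 0 \<and> cdot (c j) (?x j) \<in> \<real>" for j
    using cx'[rule_format, OF m, of j] by (rule conjunct1, simp)
  define U :: "complex^'n^'n" where "U = (\<chi> i j. c j $ i)"
  define Q :: "complex^'n^'n" where "Q = (\<chi> i j. if rk i \<le> rk j then cdot (c i) (?x j) else 0)"
  show ?thesis
  proof
    show "unitary U" using c
      by (simp add: unitary_def vec_eq_iff matrix_mult_component mat_def U_def cdot_def)
    show "upper Q" by (simp add: upper_def Q_def)
    show "X = U ** Q"
    proof (simp add: vec_eq_iff, intro allI)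
      fix i j
      have "X $ i $ j = (\<Sum>k | rk k \<le> rk j. cdot (c k) (?x j) *s c k) $ i"
        by (subst cx[of j, symmetric]) (simp add: column_def)
      also have "\<dots> = (\<Sum>k\<in>UNIV. if rk k \<le> rk j then cdot (c k) (?x j) * c k $ i else 0)"
        by (simp add: sum.If_cases)
      also have "\<dots> = (U ** Q) $ i $ j"
        by (auto simp: matrix_mult_component U_def Q_def intro!: sum.cong)
      finally show "X $ i $ j = (U ** Q) $ i $ j" .
    qed
  qed (use cn in \<open>auto simp: Q_def\<close>)
qed

section \<open>Con-Schur form and Cayley transform\<close>

lemma sum_UNIV_single:
  fixes f :: "'n::finite \<Rightarrow> 'a::comm_monoid_add"
  assumes "\<And>k. k \<noteq> a \<Longrightarrow> f k = 0"
  shows "sum f UNIV = f a"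
  using assms by (subst sum.remove[of UNIV a]) (auto intro!: sum.neutral)

section \<open>Diagonal matrices under unitary congruence\<close>

definition diag_mat :: "('n \<Rightarrow> real) \<Rightarrow> complex^'n^'n" where
  "diag_mat s = (\<chi> i j. if i = j then complex_of_real (s i) else 0)"

lemma diag_mat_right: "(A ** diag_mat s) $ i $ j = A $ i $ j * complex_of_real (s j)"
  unfolding matrix_mult_component diag_mat_def by (subst sum_UNIV_single[of j]) auto

lemma diag_mat_left: "(diag_mat s ** A) $ i $ j = complex_of_real (s i) * A $ i $ j"
  unfolding matrix_mult_component diag_mat_def by (subst sum_UNIV_single[of i]) auto

lemma rk_less_linear: "rk i < rk j \<or> i = j \<or> rk j < rk (i :: 'n::finite)"
  by (metis linorder_neqE_nat to_nat_split)

text \<open>A permutation maximizing \<open>F\<close> sorts \<open>d\<close>: by the rearrangement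
  argument, exchanging the values at an inverted pair would increase the weighted sum.\<close>

lemma sorting_permutation:
  fixes d :: "'n::finite \<Rightarrow> real"
  shows "\<exists>p :: 'n \<Rightarrow> 'n. bij p \<and> (\<forall>i j. rk i \<le> rk j \<longrightarrow> d (p i) \<le> d (p j))"
proof -
  define F where "F p = (\<Sum>i\<in>UNIV. real (rk i) * d (p i))" for p :: "'n \<Rightarrow> 'n"
  define A where "A = {p :: 'n \<Rightarrow> 'n. bij p}"
  have fin: "finite (F ` A)" by simp
  have ne: "F ` A \<noteq> {}" using bij_id by (auto simp: A_def)
  obtain p where p: "p \<in> A" "F p = Max (F ` A)" using Max_in[OF fin ne] by auto
  have max: "F q \<le> F p" if "q \<in> A" for q using Max_ge[OF fin] that p by auto
  have "d (p i) \<le> d (p j)" if ij: "rk i < rk j" for i j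
  proof -
    define q where "q = p(i := p j, j := p i)"
    have ne: "i \<noteq> j" using ij by auto
    have "q = p \<circ> Transposition.transpose i j"
      by (auto simp: q_def fun_eq_iff Transposition.transpose_def)
    then have "q \<in> A" using p by (simp add: A_def bij_comp)
    have *: "F r = real (rk i) * d (r i) + (real (rk j) * d (r j) +
      (\<Sum>k\<in>UNIV - {i} - {j}. real (rk k) * d (r k)))" for r
      unfolding F_def using ne by (subst sum.remove[of UNIV i], simp,
          simp) (subst sum.remove[of _ j], auto)
    have "(\<Sum>k\<in>UNIV - {i} - {j}. real (rk k) * d (q k)) = (\<Sum>k\<in>UNIV - {i} - {j}. real (rk k) * d (p k))"
      by (intro sum.cong) (auto simp: q_def)
    moreover have "q i = p j" "q j = p i" using ne by (auto simp: q_def)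
    ultimately have "F q - F p = (real (rk j) - real (rk i)) * (d (p i) - d (p j))"
      unfolding *[of q] *[of p] by (simp add: algebra_simps)
    then have "(real (rk j) - real (rk i)) * (d (p i) - d (p j)) \<le> 0"
      using max[OF \<open>q \<in> A\<close>] by simp
    then show ?thesis using ij by (simp add: mult_le_0_iff)
  qed
  then have "\<forall>i j. rk i \<le> rk j \<longrightarrow> d (p i) \<le> d (p j)" by (auto simp: le_less)
  then show ?thesis using p(1) by (auto simp: A_def)
qed

definition nonneg_sorted :: "('n::finite \<Rightarrow> real) \<Rightarrow> bool" where
  "nonneg_sorted s \<longleftrightarrow> (\<forall>i. 0 \<le> s i) \<and> (\<forall>i j. rk i \<le> rk j \<longrightarrow> s i \<le> s j)"

text \<open>Under congruence by \<open>V\<close> and its transpose the phases of \<open>V\<close>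
  enter squared. Square roots of the phases of \<open>D\<close> thus make the entries nonnegative,
  and a permutation sorts them.\<close>

lemma diagonal_congruent_nonneg_sorted:
  fixes D :: "complex^'n^'n"
  assumes "diagonal_matrix D"
  obtains V s where "unitary V" "nonneg_sorted s" "D = V ** diag_mat s ** transpose V"
proof -
  obtain p :: "'n \<Rightarrow> 'n" where p: "bij p"
    "\<forall>i j. rk i \<le> rk j \<longrightarrow> cmod (D $ p i $ p i) \<le> cmod (D $ p j $ p j)"
    using sorting_permutation[of "\<lambda>i. cmod (D $ i $ i)"] by blast
  define q where "q = inv p"
  have q: "j = q i \<longleftrightarrow> i = p j" for i j
    using p(1) unfolding q_def by (metis bij_inv_eq_iff)
  \<comment> \<open>A zero entry has no phase; the value 1 keeps \<open>w i\<close> of modulus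
    one.\<close>
  define w :: "'n \<Rightarrow> complex"
      where "w i = (if D $ i $ i = 0 then 1 else csqrt (D $ i $ i / cmod (D $ i $ i)))" for i
  have w1: "w i * w i * cmod (D $ i $ i) = D $ i $ i" for i
    by (simp add: w_def power2_eq_square[symmetric])
  have w2: "cnj (w i) * w i = 1" for i
  proof -
    have "cmod (w i) = 1" by (auto simp: w_def norm_divide)
    then show ?thesis using complex_norm_square[of "w i"] by (simp add: mult.commute)
  qed
  define V :: "complex^'n^'n" where "V = (\<chi> i j. if i = p j then w i else 0)"
  define s where "s j = cmod (D $ p j $ p j)" for j
  have "unitary V" unfolding unitary_def vec_eq_iff
  proof (intro allI)
    fix i j
    have "(adj V ** V) $ i $ j = cnj (V $ p i $ i) * V $ p i $ j"
      unfolding matrix_mult_component by (subst sum_UNIV_single[of "p i"]) (auto simp: V_def)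
    also have "\<dots> = mat 1 $ i $ j"
      using p(1) by (auto simp: V_def w2 mat_def bij_def inj_eq)
    finally show "(adj V ** V) $ i $ j = mat 1 $ i $ j" .
  qed
  moreover have "nonneg_sorted s" using p(2) by (auto simp: nonneg_sorted_def s_def)
  moreover have "D = V ** diag_mat s ** transpose V" unfolding vec_eq_iff
  proof (intro allI)
    fix i j
    have "(V ** diag_mat s ** transpose V) $ i $ j = V $ i $ q i * s (q i) * V $ j $ q i"
      unfolding matrix_mult_component[of "V ** diag_mat s"] diag_mat_right
      by (subst sum_UNIV_single[of "q i"]) (auto simp: V_def q)
    also have "\<dots> = D $ i $ j"
    proof (cases "i = j")
      case True
      have "p (q i) = i" using q by metis
      then show ?thesis using True w1[of i] by (simp add: V_def s_def ac_simps)
    next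
      case False
      then show ?thesis using assms q[of "q i" j] q[of "q i" i]
          by (auto simp: V_def diagonal_matrix_def)
    qed
    finally show "D $ i $ j = (V ** diag_mat s ** transpose V) $ i $ j" by simp
  qed
  ultimately show ?thesis using that by blast
qed

text \<open>Absorbing \<open>V\<close> turns \<open>X ** V = U ** Q\<close> into a matrix of
  coneigenvectors for the sorted values \<open>s\<close>. Then
  \<open>T ** conj_mat Q = Q ** diag_mat s\<close> with \<open>Q\<close> triangular forces
  \<open>T\<close> to be triangular, and its diagonal is \<open>s\<close> because that of
  \<open>Q\<close> is real.\<close>

lemma con_schur:
  fixes M X D :: "complex^'n^'n"
  assumes "invertible X" "diagonal_matrix D" "M ** conj_mat X = X ** D"
  obtains U T s where "unitary U" "upper T" "nonneg_sorted s" "\<And>i::'n. T $ i $ i =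
      complex_of_real (s i)"
    "M = U ** T ** transpose U"
proof -
  obtain V s where V: "unitary V" "nonneg_sorted s" and D: "D = V ** diag_mat s ** transpose V"
    using diagonal_congruent_nonneg_sorted[OF assms(2)] .
  have "invertible (X ** V)" using assms(1) V unitary_invertible invertible_mult by blast
  then obtain U Q where U: "unitary U" and Q: "upper Q" "\<And>i. Q $ i $ i \<in> \<real>" "\<And>i. Q $ i $ i \<noteq> 0"
    and XV: "X ** V = U ** Q" using QR_decomposition by metis
  define T where "T = adj U ** M ** conj_mat U"
  have M: "M = U ** T ** transpose U"
    unfolding T_def by (metis U matrix_mul_assoc matrix_mul_lid matrix_mul_rid unitaryD(2,4))
  have "T ** conj_mat Q = adj U ** (M ** conj_mat (X ** V))"
    unfolding T_def XV conj_mat_mult by (simp add: matrix_mul_assoc)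
  also have "M ** conj_mat (X ** V) = X ** V ** diag_mat s ** (transpose V ** conj_mat V)"
    unfolding conj_mat_mult by (simp add: matrix_mul_assoc assms(3) D)
  also have "\<dots> = U ** Q ** diag_mat s" using V by (simp add: unitaryD XV)
  also have "adj U ** \<dots> = Q ** diag_mat s"
    using U by (simp add: matrix_mul_assoc unitaryD)
  finally have TQ: "T ** conj_mat Q = Q ** diag_mat s" .
  \<comment> \<open>\<open>T\<close> is found column by column instead of by inverting
    \<open>Q\<close>: once row \<open>i\<close> vanishes before column \<open>j\<close>, a single
    term of the product survives.\<close>
  have main: "T $ i $ j * cnj (Q $ j $ j) = Q $ i $ j * s j"
    if "rk j \<le> rk i" "\<And>k. rk k < rk j \<Longrightarrow> T $ i $ k = 0" for i j
  proof -
    have "(T ** conj_mat Q) $ i $ j = T $ i $ j * cnj (Q $ j $ j)"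
      unfolding matrix_mult_component
    proof (subst sum_UNIV_single[of j])
      fix k assume "k \<noteq> j"
      then show "T $ i $ k * conj_mat Q $ k $ j = 0"
        using that Q(1) rk_less_linear[of k j] by (auto simp: upper_def)
    qed simp
    then show ?thesis unfolding TQ diag_mat_right by simp
  qed
  have low: "\<forall>i. rk j < rk i \<longrightarrow> T $ i $ j = 0" for j
  proof (induction "rk j" arbitrary: j rule: less_induct)
    case less
    show ?case
    proof (intro allI impI)
      fix i :: 'n assume i: "rk j < rk i"
      have "T $ i $ j * cnj (Q $ j $ j) = Q $ i $ j * s j"
        using less i by (intro main) auto
      also have "Q $ i $ j = 0" using Q(1) i by (simp add: upper_def)
      finally show "T $ i $ j = 0" using Q(3) by simp
    qed
  qed
  have "T $ j $ j = s j" for j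
  proof -
    have "T $ j $ j * cnj (Q $ j $ j) = Q $ j $ j * s j" using low by (intro main) auto
    then show ?thesis using Q(2,3)[of j] by (simp add: Reals_cnj_iff)
  qed
  moreover have "upper T" using low by (simp add: upper_def)
  ultimately show ?thesis using that[OF U _ V(2) _ M] by blast
qed

section \<open>Sign matrices and avoiding the eigenvalue -1\<close>

definition sign_mat :: "'n set \<Rightarrow> complex^'n^'n" where
  "sign_mat J = (\<chi> i j. if i = j then (if i \<in> J then -1 else 1) else 0)"

lemma sign_mat_right: "(A ** sign_mat J) $ i $ j = (if j \<in> J then - (A $ i $ j) else A $ i $ j)"
  unfolding matrix_mult_component sign_mat_def by (subst sum_UNIV_single[of j]) auto

lemma sign_mat_left: "(sign_mat J ** A) $ i $ j = (if i \<in> J then - (A $ i $ j) else A $ i $ j)"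
  unfolding matrix_mult_component sign_mat_def by (subst sum_UNIV_single[of i]) auto

lemma sign_mat_sign_mat [simp]: "sign_mat J ** sign_mat J = mat 1"
  unfolding vec_eq_iff sign_mat_right by (auto simp: sign_mat_def mat_def)

lemma sign_mat_cancel [simp]: "A ** sign_mat J ** sign_mat J = A"
  by (simp add: matrix_mul_assoc[symmetric])

lemma sign_mat_sym [simp]: "transpose (sign_mat J) = sign_mat J" "adj (sign_mat J) =
    sign_mat J" "conj_mat (sign_mat J) = sign_mat J"
  by (auto simp: vec_eq_iff sign_mat_def)

lemma unitary_sign_mat [simp]: "unitary (sign_mat J)"
  by (simp add: unitary_def)

lemma adj_add: "adj (A + B) = adj A + adj B" "adj (A - B) = adj A - adj B" "adj (- A) = - adj A"
  by (simp_all add: vec_eq_iff)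

lemma matrix_mult_simps: 
  fixes A B C :: "complex^'n^'n"
  shows "(A + B) ** C = A ** C + B ** C" "A ** (B + C) = A ** B + A ** C"
    "(A - B) ** C = A ** C - B ** C" "A ** (B - C) = A ** B - A ** C"
    "(- A) ** B = - (A ** B)" "A ** (- B) = - (A ** B)"
  by (simp_all add: vec_eq_iff matrix_mult_component algebra_simps sum.distrib sum_subtractf sum_negf)

text \<open>
  The sum over all sign vectors \<open>e\<close> of \<open>(\<Prod>i. e i) * det (diag e + U)\<close> is \<open>2 ^ n\<close>, because the
  determinant is affine in every \<open>e i\<close>.
\<close>

lemma exists_signs_det_nonzero:
  fixes U :: "complex^'n^'n"
  shows "\<exists>J. det (mat 1 + U ** sign_mat J) \<noteq> 0"
proof (rule ccontr)
  assume "\<not> ?thesis"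
  then have 0: "det (mat 1 + U ** sign_mat J) = 0" for J by blast
  let ?E = "PiE (UNIV :: 'n set) (\<lambda>_. {1, -1 :: complex})"
  define B where "B e = (\<chi> i j. (if i = j then e i else 0) + U $ i $ j)" for e :: "'n \<Rightarrow> complex"
  have B0: "det (B e) = 0" if "e \<in> ?E" for e
  proof -
    define J where "J = {i. e i = -1}"
    have e: "e i = 1 \<or> e i = -1" for i using that by (auto simp: PiE_def Pi_def)
    have "B e = sign_mat J + U"
      using e by (auto simp: vec_eq_iff B_def sign_mat_def J_def)
    also have "\<dots> = (mat 1 + U ** sign_mat J) ** sign_mat J" by (simp add: matrix_mult_simps(1))
    finally show ?thesis using 0 by (simp add: det_mul)
  qed
  have "0 = (\<Sum>e\<in>?E. (\<Prod>i\<in>UNIV. e i) * det (B e))" using B0 by simp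
  also have "\<dots> = (\<Sum>e\<in>?E. \<Sum>p | p permutes UNIV. of_int (sign p) *
      (\<Prod>i\<in>UNIV. e i * ((if i = p i then e i else 0) + U $ i $ p i)))"
    unfolding det_def B_def sum_distrib_left prod.distrib by (intro sum.cong) auto
  also have "\<dots> = (\<Sum>p | p permutes UNIV. of_int (sign p) *
      (\<Sum>e\<in>?E. \<Prod>i\<in>UNIV. e i * ((if i = p i then e i else 0) + U $ i $ p i)))"
    unfolding sum_distrib_left by (rule sum.swap)
  also have "\<dots> = (\<Sum>p | p permutes UNIV. of_int (sign p) *
      (\<Prod>i\<in>UNIV. (\<chi> i j. if i = j then 2 else 0 :: complex^'n^'n) $ i $ p i))"
  proof (intro sum.cong refl arg_cong2[where f = "(*)"])
    fix p :: "'n \<Rightarrow> 'n"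
    have "(\<Sum>e\<in>?E. \<Prod>i\<in>UNIV. e i * ((if i = p i then e i else 0) + U $ i $ p i)) =
      (\<Prod>i\<in>UNIV. \<Sum>y\<in>{1,-1}. y * ((if i = p i then y else 0) + U $ i $ p i))"
      by (rule prod_sum_PiE[symmetric]) auto
    also have "\<dots> = (\<Prod>i\<in>UNIV. (\<chi> i j. if i = j then 2 else 0 :: complex^'n^'n) $ i $ p i)"
      by (intro prod.cong) auto
    finally show "(\<Sum>e\<in>?E. \<Prod>i\<in>UNIV. e i * ((if i = p i then e i else 0) + U $ i $ p i)) = \<dots>" .
  qed
  also have "\<dots> = det (\<chi> i j. if i = j then 2 else 0 :: complex^'n^'n)" by (simp add: det_def)
  also have "\<dots> = 2 ^ CARD('n)" by (subst det_diagonal) auto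
  finally show False by simp
qed

lemma matrix_inv_unique: "A ** B = mat 1 \<Longrightarrow> matrix_inv A = (B :: complex^'n^'n)"
  by (metis invertible_def matrix_inv_mult(1) matrix_left_right_inverse matrix_mul_assoc
      matrix_mul_lid matrix_mul_rid)

definition antiherm :: "complex^'n^'n \<Rightarrow> bool" where
  "antiherm A \<longleftrightarrow> adj A = - A"

text \<open>The classical \<open>(1 - A) (1 + A)^(-1)\<close>, rewritten with a single occurrence of
  \<open>A\<close> so that only the resolvent has to be differentiated.\<close>

definition cayley :: "complex^'n^'n \<Rightarrow> complex^'n^'n" where
  "cayley A = matrix_inv (mat 1 + A) + matrix_inv (mat 1 + A) - mat 1"

lemma cdot_adj: "cdot (adj A *v x) y = cdot x (A *v y)"
  unfolding cdot_def matrix_vector_mult_def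
  by (simp add: sum_distrib_left sum_distrib_right)
    (subst sum.swap, simp add: ac_simps)

text \<open>If \<open>A x = -x\<close>, moving \<open>A\<close> across the Hermitian product shows
  that \<open>cdot x x\<close> equals its own negative.\<close>

lemma antiherm_invertible:
  fixes A :: "complex^'n^'n"
  assumes "antiherm A"
  shows "invertible (mat 1 + A)"
proof -
  have "x = 0" if "(mat 1 + A) *v x = 0" for x
  proof -
    have "A *v x = - x"
      using that by (simp add: matrix_vector_mult_add_rdistrib eq_neg_iff_add_eq_0 add.commute)
    moreover have "cdot (adj A *v x) x = - cdot (A *v x) x"
      using assms by (simp add: antiherm_def cdot_def vec_eq_iff matrix_vector_mult_def
          sum_negf sum_distrib_right)
    moreover have "cdot x (- x) = - cdot x x" "cdot (- x) x = - cdot x x"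
      by (simp_all add: cdot_def sum_negf)
    ultimately have "cdot x x = 0" using cdot_adj[of A x x] by simp
    then show ?thesis by (simp add: cdot_self)
  qed
  then have "\<exists>B. B ** (mat 1 + A) = mat 1" by (simp add: matrix_left_invertible_ker)
  then show ?thesis by (simp add: invertible_left_inverse)
qed

text \<open>With \<open>V = (1 + A)^(-1)\<close>, unitarity of \<open>2 V - 1\<close> amounts to
  \<open>2 V^* V = V + V^*\<close>. This follows by placing \<open>(1 + A) + (1 - A) = 2\<close>
  between \<open>V^*\<close> and \<open>V\<close>.\<close>

lemma cayley_unitary:
  fixes A :: "complex^'n^'n"
  assumes "antiherm A"
  shows "unitary (cayley A)"
proof -
  define V where "V = matrix_inv (mat 1 + A)"
  have i: "invertible (mat 1 + A)" using antiherm_invertible[OF assms] .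
  note V = matrix_inv_mult[OF i, folded V_def]
  have 1: "(mat 1 + A) ** V = mat 1" by (rule V)
  have 2: "adj V ** (mat 1 - A) = mat 1"
    using arg_cong[OF 1, of adj] assms by (simp add: adj_mult adj_add antiherm_def)
  have "adj V ** ((mat 1 + A) + (mat 1 - A)) ** V = adj V + V"
  proof -
    have "adj V ** ((mat 1 + A) + (mat 1 - A)) ** V =
        adj V ** ((mat 1 + A) ** V) + (adj V ** (mat 1 - A)) ** V"
      unfolding matrix_mult_simps(1,2)[of "adj V"] matrix_mult_simps(1) by (simp only: matrix_mul_assoc)
    then show ?thesis unfolding 1 2 by simp
  qed
  moreover have "adj V ** ((mat 1 + A) + (mat 1 - A)) ** V = adj V ** (mat 1 + mat 1) ** V" by simp
  ultimately have "adj V ** V + adj V ** V = adj V + V"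
    by (simp only: matrix_mult_simps matrix_mul_rid)
  then show ?thesis
    unfolding unitary_def cayley_def V_def[symmetric]
    by (simp only: adj_add adj_mat1 matrix_mult_simps matrix_mul_lid matrix_mul_rid) (simp add:
        algebra_simps)
qed

lemma cayley_plus_1: "mat 1 + cayley A = matrix_inv (mat 1 + A) + matrix_inv (mat 1 + A)"
  by (simp add: cayley_def)

lemma half_matrix: "V + V = W + W \<Longrightarrow> V = (W :: complex^'n^'n)"
  by (simp add: vec_eq_iff)

lemma double_half_mult: "(V + V) ** ((1/2) *\<^sub>R B) = V ** (B :: complex^'n^'n)"
proof -
  have "(a + a) * ((1/2) *\<^sub>R b) = a * b" for a b :: complex
    by (simp add: scaleR_conv_of_real)
  then show ?thesis by (simp only: vec_eq_iff matrix_mult_component vector_add_component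
      vector_scaleR_component) simp
qed

text \<open>\<open>1 + cayley A\<close> is twice the inverse of \<open>1 + A\<close>.\<close>

lemma cayley_det:
  assumes "antiherm A"
  shows "det (mat 1 + cayley A) \<noteq> 0"
proof -
  define V where "V = matrix_inv (mat 1 + A)"
  have V: "(mat 1 + A) ** V = mat 1"
    using matrix_inv_mult[OF antiherm_invertible[OF assms]] by (simp add: V_def)
  have "(V + V) ** ((1/2) *\<^sub>R (mat 1 + A)) = V ** (mat 1 + A)" by (rule double_half_mult)
  also have "\<dots> = mat 1" using V matrix_left_right_inverse by blast
  finally have "invertible (V + V)"
    using matrix_left_right_inverse invertible_def by blast
  then show ?thesis unfolding cayley_plus_1 V_def[symmetric] by (simp add: invertible_det_nz)
qed

lemma cayley_inj:
  assumes "antiherm A" "antiherm B" "cayley A = cayley B"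
  shows "A = (B :: complex^'n^'n)"
proof -
  have "matrix_inv (mat 1 + A) = matrix_inv (mat 1 + B)"
    using assms(3) by (rule_tac half_matrix) (simp add: cayley_def)
  then have "mat 1 + A = mat 1 + B"
    using matrix_inv_mult[OF antiherm_invertible[OF assms(1)]] matrix_inv_mult[OF
        antiherm_invertible[OF assms(2)]]
    by (metis matrix_mul_assoc matrix_mul_lid matrix_mul_rid)
  then show ?thesis by simp
qed

text \<open>The Cayley transform is an involution, so the witness is \<open>cayley U\<close>.
  Unitarity of \<open>U\<close> says that \<open>W + adj W\<close> is the identity, which makes
  \<open>2 W - 1 = W - adj W\<close> skew-Hermitian.\<close>

lemma cayley_surj:
  fixes U :: "complex^'n^'n"
  assumes U: "unitary U" and "det (mat 1 + U) \<noteq> 0"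
  obtains A where "antiherm A" "cayley A = U"
proof
  define W where "W = matrix_inv (mat 1 + U)"
  have i: "invertible (mat 1 + U)" using assms by (simp add: invertible_det_nz)
  note W = matrix_inv_mult[OF i, folded W_def]
  have W': "adj W ** (mat 1 + adj U) = mat 1"
    using arg_cong[OF W(1), of adj] by (simp add: adj_mult adj_add)
  have "(mat 1 + adj U) ** (mat 1 + U) = (mat 1 + adj U) + (mat 1 + U)"
    using U by (simp add: matrix_mult_simps unitaryD)
  then have "adj W ** ((mat 1 + adj U) ** (mat 1 + U)) ** W =
      adj W ** ((mat 1 + adj U) + (mat 1 + U)) ** W"
    by simp
  also have "\<dots> = (adj W ** (mat 1 + adj U)) ** W + adj W ** ((mat 1 + U) ** W)"
    unfolding matrix_mult_simps(1,2)[of "adj W"] matrix_mult_simps(1) by (simp only: matrix_mul_assoc)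
  also have "\<dots> = W + adj W" unfolding W W' by simp
  also have "adj W ** ((mat 1 + adj U) ** (mat 1 + U)) ** W =
    (adj W ** (mat 1 + adj U)) ** ((mat 1 + U) ** W)" by (simp only: matrix_mul_assoc)
  also have "\<dots> = mat 1" unfolding W W' by simp
  finally have sum: "W + adj W = mat 1" by simp
  show "antiherm (cayley U)"
  proof -
    have "cayley U = W + W - mat 1" by (simp add: cayley_def W_def)
    also have "\<dots> = W - adj W" unfolding sum[symmetric] by simp
    finally show ?thesis by (simp add: antiherm_def adj_add)
  qed
  have "mat 1 + cayley U = W + W" by (simp add: cayley_plus_1 W_def)
  moreover have "(W + W) ** ((1/2) *\<^sub>R (mat 1 + U)) = W ** (mat 1 + U)" by (rule double_half_mult)
  ultimately have "matrix_inv (mat 1 + cayley U) = (1/2) *\<^sub>R (mat 1 + U)"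
    using W by (intro matrix_inv_unique) simp
  then show "cayley (cayley U) = U"
    unfolding cayley_def[of "cayley U"] by (simp add: scaleR_add_left[symmetric])
qed

section \<open>Parameters of the con-Schur form and uniqueness\<close>

text \<open>
  A single complex matrix codes all parameters: the skew-Hermitian Cayley coordinate occupies the
  strict lower triangle and the imaginary parts of the diagonal, the triangular factor with real
  diagonal occupies the rest.
\<close>

definition skew_of :: "complex^'n^'n \<Rightarrow> complex^'n^'n" where
  "skew_of Z = (\<chi> i j. if rk j < rk i then Z $ i $ j else if i = j then Complex 0 (Im (Z $ i $ i))
     else - cnj (Z $ j $ i))"

definition upper_of :: "complex^'n^'n \<Rightarrow> complex^'n^'n" where
  "upper_of Z = (\<chi> i j. if rk i < rk j then Z $ i $ j else
      if i = j then complex_of_real (Re (Z $ i $ i)) else 0)"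

definition diag_of :: "complex^'n^'n \<Rightarrow> 'n \<Rightarrow> real" where
  "diag_of Z i = Re (Z $ i $ i)"

lemma antiherm_skew_of: "antiherm (skew_of Z)"
  unfolding antiherm_def vec_eq_iff using rk_less_linear
  by (auto simp: skew_of_def complex_eq_iff)

lemma upper_upper_of: "upper (upper_of Z)" by (auto simp: upper_def upper_of_def)

lemma upper_of_diag: "upper_of Z $ i $ i = complex_of_real (diag_of Z i)"
  by (simp add: upper_of_def diag_of_def)

lemma encode_surj:
  assumes "antiherm A" "upper T" "\<And>i. T $ i $ i = complex_of_real (s i)"
  obtains Z where "skew_of Z = A" "upper_of Z = T" "diag_of Z = s"
proof
  define Z where "Z = (\<chi> i j. if rk j < rk i then A $ i $ j else
      if i = j then Complex (s i) (Im (A $ i $ i))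
     else T $ i $ j)"
  have A: "- cnj (A $ j $ i) = A $ i $ j" for i j
    using assms(1) by (metis adj_component antiherm_def minus_minus vector_uminus_component)
  have re: "Re (A $ i $ i) = 0" for i using arg_cong[OF A[of i i], of Re] by simp
  have "skew_of Z $ i $ j = A $ i $ j" for i j
    using rk_less_linear[of i j] A[of i j] re[of i] by (auto simp: skew_of_def Z_def complex_eq_iff)
  then show "skew_of Z = A" by (simp add: vec_eq_iff)
  show "upper_of Z = T" using rk_less_linear assms(2,3)
    by (auto simp: vec_eq_iff upper_of_def Z_def upper_def)
  show "diag_of Z = s" by (auto simp: diag_of_def Z_def)
qed

lemma encode_inj:
  assumes "skew_of Z = skew_of Z'" "upper_of Z = upper_of Z'"
  shows "Z = Z'"
  unfolding vec_eq_iff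
proof (intro allI)
  fix i j
  have "skew_of Z $ i $ j = skew_of Z' $ i $ j" "upper_of Z $ i $ j = upper_of Z' $ i $ j"
      using assms by simp_all
  then show "Z $ i $ j = Z' $ i $ j"
    using rk_less_linear[of i j] by (auto simp: skew_of_def upper_of_def complex_eq_iff)
qed

section \<open>Coneigenvectors of triangular matrices and uniqueness of the form\<close>

definition positive_increasing :: "('n::finite \<Rightarrow> real) \<Rightarrow> bool" where
  "positive_increasing s \<longleftrightarrow> (\<forall>i. 0 < s i) \<and> (\<forall>i j. rk i < rk j \<longrightarrow> s i < s j)"

definition conj_vec :: "complex^'n \<Rightarrow> complex^'n" where
  "conj_vec v = (\<chi> i. cnj (v $ i))"

lemma conj_vec_component [simp]: "conj_vec v $ i = cnj (v $ i)" by (simp add: conj_vec_def)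

lemma matrix_vector_component: "(A *v x) $ i = (\<Sum>k\<in>UNIV. A $ i $ k * x $ k)"
  by (simp add: matrix_vector_mult_def)

text \<open>Back substitution upwards from row \<open>j\<close>; \<open>d\<close> measures how many
  ranks above \<open>j\<close> are already solved.\<close>

lemma coneigenvector_exists:
  fixes T :: "complex^'n^'n"
  assumes T: "upper T" "\<And>i. T $ i $ i = complex_of_real (s i)" and s: "positive_increasing s"
  shows "\<exists>y. y $ j = 1 \<and> (\<forall>i. rk j < rk i \<longrightarrow> y $ i = 0) \<and>
    (\<forall>i. rk j \<le> rk i + d \<longrightarrow> (T *v conj_vec y) $ i = complex_of_real (s j) * y $ i)"
proof (induction d)
  case 0
  show ?case
  proof (intro exI[of _ "axis j 1"] conjI allI impI)
    fix i :: 'n assume "rk j \<le> rk i + 0"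
    then have i: "rk j < rk i \<or> i = j" using rk_less_linear[of i j] by auto
    have "(T *v conj_vec (axis j 1)) $ i = T $ i $ j"
      unfolding matrix_vector_component by (subst sum_UNIV_single[of j]) (auto simp: axis_def)
    then show "(T *v conj_vec (axis j 1)) $ i = complex_of_real (s j) * axis j 1 $ i"
      using i T by (auto simp: axis_def upper_def)
  qed (auto simp: axis_def)
next
  case (Suc d)
  then obtain y where y: "y $ j = 1" "\<And>i. rk j < rk i \<Longrightarrow> y $ i = 0"
    "\<And>i. rk j \<le> rk i + d \<Longrightarrow> (T *v conj_vec y) $ i = complex_of_real (s j) * y $ i" by blast
  show ?case
  proof (cases "\<exists>i::'n. rk j = rk i + Suc d")
    case False
    then have "rk j \<le> rk i + Suc d \<Longrightarrow> rk j \<le> rk i + d" for i :: 'n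
      by (metis add_Suc_right le_SucE)
    then show ?thesis using y by blast
  next
    case True
    then obtain i :: 'n where i: "rk j = rk i + Suc d" ..
    define c where "c = (\<Sum>k\<in>UNIV - {i}. T $ i $ k * cnj (y $ k))"
    \<comment> \<open>The new entry must solve \<open>s i * cnj v + c = s j * v\<close>. Real and
      imaginary parts decouple, with coefficients \<open>s j - s i\<close> and
      \<open>s j + s i\<close>, both positive here.\<close>
    define v where "v = Complex (Re c / (s j - s i)) (Im c / (s j + s i))"
    have "s i < s j" "0 < s i" using i s by (auto simp: positive_increasing_def)
    then have v: "complex_of_real (s i) * cnj v + c = complex_of_real (s j) * v"
      by (simp add: complex_eq_iff v_def field_simps)
    define z where "z = (\<chi> k. if k = i then v else y $ k)"
    show ?thesis
    proof (intro exI[of _ z] conjI allI impI)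
      show "z $ j = 1" using i y by (auto simp: z_def)
      fix l :: 'n assume "rk j < rk l"
      then show "z $ l = 0" using i y by (auto simp: z_def)
    next
      fix l :: 'n assume l: "rk j \<le> rk l + Suc d"
      show "(T *v conj_vec z) $ l = complex_of_real (s j) * z $ l"
      proof (cases "l = i")
        case True
        have "(T *v conj_vec z) $ i = T $ i $ i * cnj v + (\<Sum>k\<in>UNIV - {i}. T $ i $ k * conj_vec z $ k)"
          unfolding matrix_vector_component by (subst sum.remove[of UNIV i]) (auto simp: z_def)
        also have "(\<Sum>k\<in>UNIV - {i}. T $ i $ k * conj_vec z $ k) = c"
          unfolding c_def by (intro sum.cong) (auto simp: z_def)
        finally show ?thesis using True v T(2) by (simp add: z_def)
      next
        case False
        then have l: "rk j \<le> rk l + d" "rk i < rk l"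
          using l i rk_less_linear[of l i] by auto
        have "(T *v conj_vec z) $ l = (T *v conj_vec y) $ l"
          unfolding matrix_vector_component using l(2) T(1)
              by (intro sum.cong) (auto simp: z_def upper_def)
        then show ?thesis using y(3)[OF l(1)] False by (simp add: z_def)
      qed
    qed
  qed
qed

text \<open>The coneigenvectors are normalized to 1 at their own index and vanish after it, so their
  matrix is unitriangular and has determinant 1.\<close>

lemma upper_condiagonalize:
  fixes T :: "complex^'n^'n"
  assumes T: "upper T" "\<And>i. T $ i $ i = complex_of_real (s i)" and s: "positive_increasing s"
  obtains Y where "invertible Y" "T ** conj_mat Y = Y ** diag_mat s"
proof -
  have "\<exists>y. y $ j = 1 \<and> (\<forall>i. rk j < rk i \<longrightarrow> y $ i = 0) \<and> (T *v conj_vec y) = s j *s y" for j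
    using coneigenvector_exists[OF assms, of j "rk j"] by (simp add: vec_eq_iff)
  then obtain y where y: "\<And>j. y j $ j = 1" "\<And>i j. rk j < rk i \<Longrightarrow> y j $ i = 0"
    "\<And>j. (T *v conj_vec (y j)) = s j *s y j" by metis
  define Y where "Y = (\<chi> i j. y j $ i)"
  have "det (transpose Y) = det (mat 1 :: complex^'n^'n)"
    using y by (intro det_block_triangular_eq[where w = rk]) (auto simp: Y_def mat_def)
  then have "invertible Y" by (simp add: invertible_det_nz)
  moreover have "T ** conj_mat Y = Y ** diag_mat s"
  proof -
    have "(T ** conj_mat Y) $ i $ j = (Y ** diag_mat s) $ i $ j" for i j
      using arg_cong[OF y(3)[of j], of "\<lambda>v. v $ i"]
      unfolding diag_mat_right by (simp add: matrix_mult_component matrix_vector_component Y_def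
          mult.commute)
    then show ?thesis by (simp add: vec_eq_iff)
  qed
  ultimately show ?thesis using that by blast
qed

text \<open>In the row of the last nonzero entry of \<open>u\<close> only the diagonal of
  \<open>T\<close> contributes; comparing moduli there identifies \<open>c\<close>.\<close>

lemma coneigenvalue_upper:
  fixes T :: "complex^'n^'n"
  assumes T: "upper T" "\<And>i. T $ i $ i = complex_of_real (s i)" and s: "\<And>i. 0 < s i"
    and u: "u \<noteq> 0" "T *v conj_vec u = complex_of_real c *s u" "c > 0"
  shows "c \<in> range s"
proof -
  let ?K = "{k. u $ k \<noteq> 0}"
  have "finite (rk ` ?K)" "rk ` ?K \<noteq> {}" using u(1) by (auto simp: vec_eq_iff)
  then have "Max (rk ` ?K) \<in> rk ` ?K" by (rule Max_in)
  then obtain m where m: "u $ m \<noteq> 0" "rk m = Max (rk ` ?K)" by (elim imageE) auto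
  have 0: "u $ k = 0" if "rk m < rk k" for k
  proof (rule ccontr)
    assume "u $ k \<noteq> 0"
    then have "rk k \<le> Max (rk ` ?K)" by (intro Max_ge) auto
    then show False using that m(2) by simp
  qed
  have "(T *v conj_vec u) $ m = T $ m $ m * cnj (u $ m)"
    unfolding matrix_vector_component
  proof (subst sum_UNIV_single[of m])
    fix k assume "k \<noteq> m"
    then show "T $ m $ k * conj_vec u $ k = 0"
      using T(1) 0[of k] rk_less_linear[of k m] by (auto simp: upper_def)
  qed simp
  then have "complex_of_real (s m) * cnj (u $ m) = complex_of_real c * u $ m"
    using u(2) T(2) by simp
  then have "cmod (complex_of_real (s m) * cnj (u $ m)) = cmod (complex_of_real c * u $ m)" by simp
  then have "s m = c" using m(1) s[of m] u(3) by (simp add: norm_mult)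
  then show ?thesis by blast
qed

text \<open>Writing \<open>s = t o p\<close>, the map \<open>p\<close> is strictly increasing on a
  finite linear order. It embeds the predecessors of \<open>i\<close> into those of
  \<open>p i\<close>, and likewise the successors, so it can move no index down or up.\<close>

lemma positive_increasing_range_subset:
  fixes s t :: "'n::finite \<Rightarrow> real"
  assumes "positive_increasing s" "positive_increasing t" "range s \<subseteq> range t"
  shows "s = t"
proof -
  have "\<forall>i. \<exists>k. s i = t k" using assms(3) by (auto simp: image_iff subset_iff)
  then obtain p where p: "\<And>i. s i = t (p i)" by metis
  have lt: "rk (p i) < rk (p j)" if "rk i < rk j" for i j
    using assms(1,2) that p rk_less_linear[of "p i" "p j"] unfolding positive_increasing_def
    by (metis order_less_asym order_less_irrefl)
  have inj: "inj p"
    by (rule injI) (metis lt less_irrefl rk_less_linear)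
  have 1: "rk i \<le> rk (p i)" for i
  proof (rule ccontr)
    assume "\<not> ?thesis"
    then have "rk (p i) < rk i" by simp
    then have "p i \<in> {k::'n. rk k < rk i}" "{k::'n. rk k < rk (p i)} \<subseteq> {k::'n. rk k < rk i}" by auto
    then have "{k::'n. rk k < rk (p i)} \<subset> {k::'n. rk k < rk i}" by blast
    then have "card {k::'n. rk k < rk (p i)} < card {k::'n. rk k < rk i}"
        by (intro psubset_card_mono) auto
    moreover have "card {k::'n. rk k < rk i} \<le> card {k::'n. rk k < rk (p i)}"
      using inj lt by (intro card_inj_on_le[of p]) (auto intro: inj_on_subset)
    ultimately show False by simp
  qed
  have 2: "rk (p i) \<le> rk i" for i
  proof (rule ccontr)
    assume "\<not> ?thesis"
    then have "rk i < rk (p i)" by simp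
    then have "p i \<in> {k::'n. rk i < rk k}" "{k::'n. rk (p i) < rk k} \<subseteq> {k::'n. rk i < rk k}" by auto
    then have "{k::'n. rk (p i) < rk k} \<subset> {k::'n. rk i < rk k}" by blast
    then have "card {k::'n. rk (p i) < rk k} < card {k::'n. rk i < rk k}"
        by (intro psubset_card_mono) auto
    moreover have "card {k::'n. rk i < rk k} \<le> card {k::'n. rk (p i) < rk k}"
      using inj lt by (intro card_inj_on_le[of p]) (auto intro: inj_on_subset)
    ultimately show False by simp
  qed
  have "p i = i" for i using 1[of i] 2[of i] by (metis le_antisym to_nat_split)
  then show ?thesis using p by auto
qed

text \<open>Induction over the rows: once the earlier rows are diagonal, column \<open>i\<close>
  contains only its diagonal entry, which has modulus one, so the unit row \<open>i\<close> has no
  room for another entry.\<close>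

lemma unitary_upper_diagonal:
  assumes V: "unitary V" "upper V" and "i \<noteq> j"
  shows "V $ i $ j = 0"
proof -
  have *: "\<forall>j. j \<noteq> i \<longrightarrow> V $ i $ j = 0" for i
  proof (induction "rk i" arbitrary: i rule: less_induct)
    case less
    have "(adj V ** V) $ i $ i = cnj (V $ i $ i) * V $ i $ i"
      unfolding matrix_mult_component
    proof (subst sum_UNIV_single[of i])
      fix k assume "k \<noteq> i"
      then show "adj V $ i $ k * V $ k $ i = 0"
        using V(2) less[of k] rk_less_linear[of k i] by (auto simp: upper_def)
    qed simp
    then have a: "V $ i $ i * cnj (V $ i $ i) = 1"
      using V(1) by (simp add: unitaryD mat_def mult.commute)
    have "(V ** adj V) $ i $ i = (\<Sum>k\<in>UNIV. V $ i $ k * cnj (V $ i $ k))"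
      by (simp add: matrix_mult_component)
    also have "\<dots> = 1 + (\<Sum>k\<in>UNIV - {i}. V $ i $ k * cnj (V $ i $ k))"
      by (subst sum.remove[of UNIV i]) (auto simp: a)
    also have "\<dots> = 1 + complex_of_real (\<Sum>k\<in>UNIV - {i}. (cmod (V $ i $ k))\<^sup>2)"
      unfolding of_real_sum complex_norm_square ..
    finally have "complex_of_real (\<Sum>k\<in>UNIV - {i}. (cmod (V $ i $ k))\<^sup>2) = 0"
      using V(1) by (simp add: unitaryD mat_def)
    then have "(\<Sum>k\<in>UNIV - {i}. (cmod (V $ i $ k))\<^sup>2) = 0" using of_real_eq_0_iff by blast
    then show ?case by (subst (asm) sum_nonneg_eq_0_iff) auto
  qed
  show ?thesis using *[of i] assms(3) by simp
qed

text \<open>\<open>V\<close> carries coneigenvectors of \<open>T\<close> to coneigenvectors of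
  \<open>T'\<close>, so both diagonals agree. Below the diagonal,
  \<open>V $ i $ j * s j = s i * cnj (V $ i $ j)\<close> with \<open>s j < s i\<close> then leaves
  only zero; on the diagonal it forces real entries of modulus one.\<close>

lemma schur_unique:
  fixes V T T' :: "complex^'n^'n"
  assumes V: "unitary V" and T: "upper T" "\<And>i. T $ i $ i =
      complex_of_real (s i)" "positive_increasing s"
    and T': "upper T'" "\<And>i. T' $ i $ i = complex_of_real (s' i)" "positive_increasing s'"
    and eq: "V ** T = T' ** conj_mat V"
  obtains J where "V = sign_mat J"
proof -
  have "range s \<subseteq> range s'"
  proof
    fix c assume "c \<in> range s"
    then obtain i where i: "c = s i" by blast
    obtain y where y: "y $ i = 1" "T *v conj_vec y = complex_of_real (s i) *s y"
      using coneigenvector_exists[OF T, of i "rk i"] by (auto simp: vec_eq_iff)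
    have *: "conj_mat V *v conj_vec y = conj_vec (V *v y)"
      by (simp add: vec_eq_iff matrix_vector_component)
    have "T' *v conj_vec (V *v y) = (V ** T) *v conj_vec y"
      unfolding eq *[symmetric] by (simp add: matrix_vector_mul_assoc)
    also have "\<dots> = V *v (complex_of_real (s i) *s y)"
      by (simp add: matrix_vector_mul_assoc[symmetric] y(2))
    also have "\<dots> = complex_of_real (s i) *s (V *v y)"
      by (simp add: vec_eq_iff matrix_vector_component sum_distrib_left ac_simps)
    finally have e: "T' *v conj_vec (V *v y) = complex_of_real (s i) *s (V *v y)" .
    have "V *v y \<noteq> 0"
    proof
      assume "V *v y = 0"
      then have "adj V *v (V *v y) = 0" by simp
      then have "y = 0" using V by (simp add: matrix_vector_mul_assoc unitaryD)
      then show False using y(1) by simp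
    qed
    then show "c \<in> range s'" unfolding i using e T' T(3)
      by (intro coneigenvalue_upper[of T' s']) (auto simp: positive_increasing_def)
  qed
  then have s': "s' = s" using positive_increasing_range_subset T(3) T'(3) by blast
  obtain m where "\<forall>x\<in>range (rk :: 'n \<Rightarrow> nat). x < m"
    using finite_nat_set_iff_bounded[of "range (rk :: 'n \<Rightarrow> nat)"] finite_imageI[OF finite[of UNIV]]
    by meson
  then have m: "rk j < m" for j :: 'n by (meson rangeI)
  \<comment> \<open>\<open>lo\<close> says that \<open>V\<close> vanishes farther below the diagonal
    than \<open>(i, j)\<close>; together with the triangular shapes this leaves one term on each
    side.\<close>
  have main: "V $ i $ j * s j = s i * cnj (V $ i $ j)"
    if "rk j \<le> rk i" and lo: "\<And>k l. rk l < rk k \<Longrightarrow> rk k + rk j > rk i + rk l \<Longrightarrow> V $ k $ l = 0" for i j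
  proof -
    have "(V ** T) $ i $ j = V $ i $ j * s j"
      unfolding matrix_mult_component
    proof (subst sum_UNIV_single[of j])
      fix k assume "k \<noteq> j"
      then show "V $ i $ k * T $ k $ j = 0"
        using T(1) lo[of k i] that(1) rk_less_linear[of k j] by (auto simp: upper_def)
    qed (simp add: T(2))
    moreover have "(T' ** conj_mat V) $ i $ j = s i * cnj (V $ i $ j)"
      unfolding matrix_mult_component
    proof (subst sum_UNIV_single[of i])
      fix k assume "k \<noteq> i"
      then show "T' $ i $ k * conj_mat V $ k $ j = 0"
        using T'(1) lo[of j k] that(1) rk_less_linear[of k i] by (auto simp: upper_def)
    qed (simp add: T'(2) s')
    ultimately show ?thesis by (simp add: eq)
  qed
  have low: "V $ i $ j = 0" if "rk j < rk i" for i j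
    using that
  \<comment> \<open>The induction starts at the corner farthest below the diagonal; adding
    \<open>m\<close> keeps the subtraction of naturals from truncating.\<close>
  proof (induction "m + rk j - rk i" arbitrary: i j rule: less_induct)
    case less
    have "V $ i $ j * s j = s i * cnj (V $ i $ j)"
    proof (rule main)
      fix k l :: 'n assume kl: "rk l < rk k" "rk k + rk j > rk i + rk l"
      have "m + rk l - rk k < m + rk j - rk i" using kl m[of i] m[of k] by linarith
      then show "V $ k $ l = 0" using less.hyps kl by blast
    qed (use less in auto)
    then have "cmod (V $ i $ j * s j) = cmod (s i * cnj (V $ i $ j))" by simp
    then have "cmod (V $ i $ j) * s j = s i * cmod (V $ i $ j)"
      using T(3) by (simp add: norm_mult positive_increasing_def less_imp_le abs_of_pos)
    moreover have "s j < s i" using T(3) less.prems by (simp add: positive_increasing_def)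
    ultimately show ?case by (simp add: mult.commute)
  qed
  then have "upper V" by (simp add: upper_def)
  then have off: "V $ i $ j = 0" if "i \<noteq> j" for i j using unitary_upper_diagonal[OF V] that by blast
  have di: "V $ i $ i = 1 \<or> V $ i $ i = -1" for i
  proof -
    have "V $ i $ i * s i = s i * cnj (V $ i $ i)" using low by (intro main) auto
    moreover have "s i \<noteq> 0" using T(3) by (metis less_irrefl positive_increasing_def)
    ultimately have r: "cnj (V $ i $ i) = V $ i $ i" by (simp add: mult.commute)
    have "(adj V ** V) $ i $ i = cnj (V $ i $ i) * V $ i $ i"
      unfolding matrix_mult_component using off by (subst sum_UNIV_single[of i]) auto
    then have "V $ i $ i * V $ i $ i = 1" using V r by (simp add: unitaryD mat_def)
    then show ?thesis by (metis square_eq_1_iff)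
  qed
  have "V = sign_mat {i. V $ i $ i = -1}"
    using off di by (auto simp: vec_eq_iff sign_mat_def)
  then show ?thesis using that by blast
qed

section \<open>The moving frame and Takagi factorization\<close>

lemma scaleR_matrix_mult: "(r *\<^sub>R A) ** B = r *\<^sub>R (A ** B)" "A ** (r *\<^sub>R B) =
    r *\<^sub>R (A ** (B :: complex^'n^'n))"
  by (simp_all add: vec_eq_iff matrix_mult_component scaleR_sum_right)

interpretation matrix_mult: bounded_bilinear "(**) :: complex^'n^'n \<Rightarrow> complex^'n^'n \<Rightarrow> complex^'n^'n"
proof -
  have "bilinear ((**) :: complex^'n^'n \<Rightarrow> complex^'n^'n \<Rightarrow> complex^'n^'n)"
    unfolding bilinear_def by (auto intro!: linearI simp: matrix_mult_simps scaleR_matrix_mult)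
  then show "bounded_bilinear ((**) :: complex^'n^'n \<Rightarrow> complex^'n^'n \<Rightarrow> complex^'n^'n)"
    by (simp add: bilinear_conv_bounded_bilinear)
qed

lemma linear_transpose: "linear (transpose :: complex^'n^'n \<Rightarrow> _)"
  by (auto intro!: linearI simp: vec_eq_iff)

lemma linear_adj: "linear (adj :: complex^'n^'n \<Rightarrow> _)"
  by (auto intro!: linearI simp: vec_eq_iff)

lemma linear_conj_mat: "linear (conj_mat :: complex^'n^'n \<Rightarrow> _)"
  by (auto intro!: linearI simp: vec_eq_iff)

lemma linear_skew_of: "linear skew_of"
  by (auto intro!: linearI simp: vec_eq_iff skew_of_def complex_eq_iff)

lemma linear_upper_of: "linear upper_of"
  by (auto intro!: linearI simp: vec_eq_iff upper_of_def complex_eq_iff)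

lemma linear_diag_mat_diag_of: "linear (\<lambda>Z. diag_mat (diag_of Z))"
  by (auto intro!: linearI simp: vec_eq_iff diag_mat_def diag_of_def complex_eq_iff)

lemma linear_has_derivative:
  fixes f :: "'a::euclidean_space \<Rightarrow> 'b::real_normed_vector"
  assumes "linear f"
  shows "(f has_derivative f) (at x within S)"
  using assms linear_conv_bounded_linear bounded_linear_imp_has_derivative by blast

lemma linear_cont:
  fixes f :: "'a::euclidean_space \<Rightarrow> 'b::real_normed_vector"
  assumes "linear f"
  shows "continuous_on S f"
  using assms linear_conv_bounded_linear linear_continuous_on by blast

lemma norm_sq: "(norm (M :: complex^'n^'n))\<^sup>2 = (\<Sum>i\<in>UNIV. \<Sum>j\<in>UNIV. (cmod (M $ i $ j))\<^sup>2)"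
  unfolding norm_vec_def L2_set_def by (simp add: sum_nonneg)

lemma norm_trace: "complex_of_real ((norm (M :: complex^'n^'n))\<^sup>2) = (\<Sum>j\<in>UNIV. (adj M ** M) $ j $ j)"
  unfolding norm_sq matrix_mult_component of_real_sum complex_norm_square
  by (subst sum.swap) (simp add: mult.commute)

lemma norm_unitary_left:
  fixes U M :: "complex^'n^'n"
  assumes U: "unitary U"
  shows "norm (U ** M) = norm M"
proof -
  have "adj (U ** M) ** (U ** M) = adj M ** (adj U ** U) ** M"
    by (simp only: adj_mult matrix_mul_assoc)
  then have "adj (U ** M) ** (U ** M) = adj M ** M" using U by (simp add: unitaryD)
  then have "complex_of_real ((norm (U ** M))\<^sup>2) = complex_of_real ((norm M)\<^sup>2)"
    by (simp only: norm_trace)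
  then show ?thesis by (simp only: of_real_eq_iff) (simp add: power2_eq_iff_nonneg)
qed

lemma norm_transpose: "norm (transpose M) = norm (M :: complex^'n^'n)"
proof -
  have "(norm (transpose M))\<^sup>2 = (norm M)\<^sup>2"
    unfolding norm_sq by (subst sum.swap) simp
  then show ?thesis by (simp add: power2_eq_iff_nonneg)
qed

lemma norm_congruence: "unitary U \<Longrightarrow> norm (U ** M ** transpose U) = norm (M :: complex^'n^'n)"
  by (metis matrix_transpose_mul norm_transpose norm_unitary_left transpose_transpose)

lemma norm_unitary: "unitary (U :: complex^'n^'n) \<Longrightarrow> norm U = norm (mat 1 :: complex^'n^'n)"
  using norm_unitary_left[of U "mat 1"] by simp

text \<open>The velocity \<open>U^* dU\<close> of the unitary factor in its own frame. With
  \<open>V = (1 + A)^(-1)\<close> one has \<open>dU = -2 V (dA) V\<close> and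
  \<open>V = U V^*\<close>; the resulting form \<open>-2 V^* (dA) V\<close> is visibly
  skew-Hermitian.\<close>

definition cayley_velocity :: "complex^'n^'n \<Rightarrow> complex^'n^'n \<Rightarrow> complex^'n^'n" where
  "cayley_velocity Z H = - (2 *\<^sub>R (adj (matrix_inv (mat 1 + skew_of Z)) ** skew_of H **
      matrix_inv (mat 1 + skew_of Z)))"

lemma linear_cayley_velocity: "linear (cayley_velocity Z)"
  by (auto intro!: linearI simp: cayley_velocity_def linear_add[OF linear_skew_of] linear_cmul[OF
      linear_skew_of] matrix_mult_simps scaleR_matrix_mult
      scaleR_add_right)

lemma antiherm_cayley_velocity: "antiherm (cayley_velocity Z H)"
proof -
  have "adj (skew_of H) = - skew_of H" using antiherm_skew_of antiherm_def by blast
  then show ?thesis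
    unfolding antiherm_def cayley_velocity_def adj_add linear_cmul[OF linear_adj] adj_mult adj_adj
    by (simp add: matrix_mul_assoc matrix_mult_simps)
qed

lemma cayley_has_derivative:
  "((\<lambda>Z. cayley (skew_of Z)) has_derivative (\<lambda>H. cayley (skew_of Z) **
      cayley_velocity Z H)) (at (Z :: complex^'n^'n))"
proof -
  define V where "V Z = matrix_inv (mat 1 + skew_of Z)" for Z :: "complex^'n^'n"
  have V: "(mat 1 + skew_of Z) ** V Z = mat 1" "V Z ** (mat 1 + skew_of Z) = mat 1"
      for Z :: "complex^'n^'n"
    using matrix_inv_mult[OF antiherm_invertible[OF antiherm_skew_of]] by (simp_all add: V_def)
  have U: "cayley (skew_of Z) = 2 *\<^sub>R V Z - mat 1" for Z :: "complex^'n^'n"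
    by (simp add: cayley_def V_def scaleR_2)
  have un: "unitary (cayley (skew_of Z))" for Z :: "complex^'n^'n"
      by (simp add: cayley_unitary antiherm_skew_of)
  define C where "C = norm (mat 1 :: complex^'n^'n)"
  \<comment> \<open>\<open>2 V = U + 1\<close> with \<open>U\<close> unitary bounds the resolvent
    uniformly in \<open>Z\<close>.\<close>
  have Vb: "norm (V Z) \<le> C" for Z
  proof -
    have "norm (2 *\<^sub>R V Z) = norm (cayley (skew_of Z) + mat 1)" by (simp add: U)
    also have "\<dots> \<le> C + C" unfolding C_def using norm_triangle_ineq norm_unitary[OF un] by metis
    finally show ?thesis by simp
  qed
  obtain K where encoded_differential: "K > 0" "\<forall>(A :: complex^'n^'n) (B :: complex^'n^'n). norm
      (A ** B) \<le> norm A * norm B * K"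
    using matrix_mult.pos_bounded[where 'n = 'n] by (elim exE conjE)
  note K = encoded_differential(1) encoded_differential(2)[rule_format]
  have "bounded_linear (skew_of :: complex^'n^'n \<Rightarrow> _)"
    using linear_skew_of linear_conv_bounded_linear by blast
  from bounded_linear.pos_bounded[OF this]
  obtain L where L0: "L > 0" "\<forall>H :: complex^'n^'n. norm (skew_of H) \<le> norm H * L"
    by (elim exE conjE)
  note L = L0(2)[rule_format] L0(1)
  define V' where "V' H = - (V Z ** skew_of H ** V Z)" for H
  have linV': "linear V'"
    by (auto intro!: linearI simp: V'_def linear_add[OF linear_skew_of] linear_cmul[OF
        linear_skew_of] matrix_mult_simps scaleR_matrix_mult)
  \<comment> \<open>The resolvent identity. Substituted into itself, it writes the remainder with
    two factors \<open>skew_of (Y - Z)\<close>, hence as quadratically small.\<close>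
  have diff: "V Y - V Z = - (V Y ** skew_of (Y - Z) ** V Z)" for Y
  proof -
    have "skew_of (Y - Z) = (mat 1 + skew_of Y) - (mat 1 + skew_of Z)"
      by (simp add: linear_diff[OF linear_skew_of])
    then have "V Y ** skew_of (Y - Z) ** V Z =
        (V Y ** (mat 1 + skew_of Y)) ** V Z - V Y ** ((mat 1 + skew_of Z) ** V Z)"
      by (simp only: matrix_mult_simps(3,4) matrix_mul_assoc)
    then show ?thesis unfolding V by simp
  qed
  have rem: "norm (V Y - V Z - V' (Y - Z)) \<le>
      (C * L * L * C * C * K * K * K * K) * (norm (Y - Z))\<^sup>2" for Y
  proof -
    let ?H = "skew_of (Y - Z)"
    have "V Y - V Z - V' (Y - Z) = - ((V Y - V Z) ** ?H ** V Z)"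
      unfolding V'_def matrix_mult_simps(3) using diff[of Y] by (simp add: matrix_mult_simps)
    also have "\<dots> = V Y ** ?H ** V Z ** ?H ** V Z"
      unfolding diff[of Y] matrix_mult_simps(5) by simp
    finally have "norm (V Y - V Z - V' (Y - Z)) = norm (V Y ** ?H ** V Z ** ?H ** V Z)" by simp
    also have "\<dots> \<le> norm (V Y ** ?H ** V Z ** ?H) * norm (V Z) * K" by (rule K)
    also have "\<dots> \<le> (norm (V Y ** ?H ** V Z) * norm ?H * K) * norm (V Z) * K"
      using K by (intro mult_right_mono) auto
    also have "\<dots> \<le> ((norm (V Y ** ?H) * norm (V Z) * K) * norm ?H * K) * norm (V Z) * K"
      using K by (intro mult_right_mono) auto
    also have "\<dots> \<le> (((norm (V Y) * norm ?H * K) * norm (V Z) * K) * norm ?H * K) * norm (V Z) * K"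
      using K by (intro mult_right_mono) auto
    also have "\<dots> \<le> (((C * (norm (Y - Z) * L) * K) * C * K) * (norm (Y - Z) * L) * K) * C * K"
      using K(1) Vb L C_def by (intro mult_mono) auto
    finally show ?thesis by (simp add: power2_eq_square ac_simps)
  qed
  define B where "B = C * L * L * C * C * K * K * K * K"
  have B: "B \<ge> 0" using K L by (simp add: B_def C_def)
  have "(V has_derivative V') (at Z)"
    unfolding has_derivative_at_alt
  proof (intro conjI allI impI)
    show "bounded_linear V'" using linV' linear_conv_bounded_linear by blast
    fix e :: real assume e: "e > 0"
    show "\<exists>d>0. \<forall>y. norm (y - Z) < d \<longrightarrow> norm (V y - V Z - V' (y - Z)) \<le> e * norm (y - Z)"
    proof (intro exI[of _ "e / (B + 1)"] conjI allI impI)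
      show "0 < e / (B + 1)" using e B by simp
      fix Y assume y: "norm (Y - Z) < e / (B + 1)"
      have "norm (V Y - V Z - V' (Y - Z)) \<le> (B * norm (Y - Z)) * norm (Y - Z)"
        using rem[of Y] by (simp add: B_def power2_eq_square ac_simps)
      also have "\<dots> \<le> e * norm (Y - Z)"
      proof (rule mult_right_mono)
        have "B * norm (Y - Z) \<le> (B + 1) * norm (Y - Z)" by (simp add: mult_right_mono)
        also have "\<dots> \<le> e" using y B by (simp add: field_simps)
        finally show "B * norm (Y - Z) \<le> e" .
      qed simp
      finally show "norm (V Y - V Z - V' (Y - Z)) \<le> e * norm (Y - Z)" .
    qed
  qed
  then have "((\<lambda>Z. 2 *\<^sub>R V Z - mat 1) has_derivative (\<lambda>H. 2 *\<^sub>R V' H - 0)) (at Z)"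
    by (intro has_derivative_diff has_derivative_scaleR_right has_derivative_const)
  moreover have "2 *\<^sub>R V' H - 0 = cayley (skew_of Z) ** cayley_velocity Z H" for H
  proof -
    let ?W = "adj (V Z)"
    have "adj (mat 1 + skew_of Z) = mat 1 - skew_of Z"
      using antiherm_skew_of[of Z] by (simp add: antiherm_def adj_add)
    then have W: "(mat 1 - skew_of Z) ** ?W = mat 1"
      using arg_cong[OF V(2)[of Z], of adj] by (simp add: adj_mult)
    have "cayley (skew_of Z) ** ?W = (V Z + V Z) ** ?W - (V Z ** (mat 1 + skew_of Z)) ** ?W"
      unfolding V U scaleR_2 by (simp only: matrix_mult_simps matrix_mul_lid)
    also have "\<dots> = V Z ** ((mat 1 - skew_of Z) ** ?W)"
      by (simp only: matrix_mult_simps matrix_mul_lid matrix_mul_rid matrix_mul_assoc) (simp add: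
          algebra_simps)
    finally have "cayley (skew_of Z) ** ?W = V Z" using W by simp
    then show ?thesis
      unfolding cayley_velocity_def V_def[symmetric] V'_def
          by (simp add: matrix_mul_assoc matrix_mult_simps scaleR_matrix_mult)
  qed
  ultimately show ?thesis unfolding U by simp
qed

text \<open>Product rule with \<open>dU = U W\<close>. The outer factors do not depend on the
  direction \<open>H\<close> and act as an isometry, so they drop out of the absolute
  Jacobian.\<close>

lemma congruence_has_derivative:
  fixes B :: "complex^'n^'n \<Rightarrow> complex^'n^'n"
  assumes B: "(B has_derivative B') (at Z)"
  shows "((\<lambda>Z. cayley (skew_of Z) ** B Z ** transpose (cayley (skew_of Z))) has_derivative
    (\<lambda>H. cayley (skew_of Z) ** (cayley_velocity Z H ** B Z + B Z **
        transpose (cayley_velocity Z H) + B' H) ** transpose (cayley (skew_of Z)))) (at Z)"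
proof -
  have "((\<lambda>Z. transpose (cayley (skew_of Z))) has_derivative (\<lambda>H. transpose (cayley (skew_of Z) **
      cayley_velocity Z H))) (at Z)"
    using cayley_has_derivative linear_transpose linear_conv_bounded_linear
        bounded_linear.has_derivative by blast
  from matrix_mult.FDERIV[OF matrix_mult.FDERIV[OF cayley_has_derivative B] this]
  show ?thesis
    by (rule has_derivative_eq_rhs) (simp add: fun_eq_iff matrix_mult_simps matrix_mul_assoc
        transpose_mult)
qed

section \<open>Takagi factorization by maximization over the unitary group\<close>

lemma sum_UNIV_two:
  fixes f :: "'n::finite \<Rightarrow> 'a::comm_monoid_add"
  assumes "i \<noteq> j" "\<And>k. k \<noteq> i \<Longrightarrow> k \<noteq> j \<Longrightarrow> f k = 0"
  shows "sum f UNIV = f i + f j"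
  using assms by (subst sum.remove[of UNIV i], simp, simp,
      subst sum.remove[of _ j]) (auto intro!: sum.neutral)

lemma compact_unitary: "compact {U :: complex^'n^'n. unitary U}"
proof -
  have "{U :: complex^'n^'n. unitary U} = (\<lambda>U. adj U ** U) -` {mat 1}" by (auto simp: unitary_def)
  moreover have "closed \<dots>"
    by (intro closed_vimage closed_singleton matrix_mult.continuous_on linear_cont[OF linear_adj]
        continuous_on_id)
  moreover have "bounded {U :: complex^'n^'n. unitary U}"
    unfolding bounded_iff using norm_unitary by (metis (mono_tags) mem_Collect_eq order_refl)
  ultimately show ?thesis by (simp add: compact_eq_bounded_closed)
qed

text \<open>
  At a maximum of \<open>\<Sum>l. c l * Re (N $ l $ l)\<close> over all \<open>N = U\<^sup>* S (U\<^sup>*)\<^sup>T\<close>, where the weights \<open>c l\<close> are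
  distinct and positive, criticality in the direction of the plane rotations makes \<open>N\<close> diagonal.
\<close>

lemma takagi:
  fixes S :: "complex^'n^'n"
  assumes S: "transpose S = S"
  obtains U s where "unitary U" "nonneg_sorted s" "S = U ** diag_mat s ** transpose U"
proof -
  define c where "c l = real (rk l) + 1" for l :: 'n
  define L where "L N = (\<Sum>l\<in>UNIV. c l * Re (N $ l $ l))" for N :: "complex^'n^'n"
  have linL: "linear L"
    by (auto intro!: linearI simp: L_def sum.distrib algebra_simps sum_distrib_left)
  have "continuous_on {U. unitary U} (\<lambda>U. L (adj U ** S ** conj_mat U))"
    by (intro continuous_on_compose2[OF linear_cont[OF linL, of UNIV]] matrix_mult.continuous_on
        linear_cont[OF linear_adj] linear_cont[OF linear_conj_mat] continuous_on_const) auto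
  note cont = this
  have ne: "{U :: complex^'n^'n. unitary U} \<noteq> {}" using unitary_mat1 by blast
  from continuous_attains_sup[OF compact_unitary ne cont]
  obtain U where U: "unitary U"
    and max': "\<forall>V\<in>{V. unitary V}. L (adj V ** S ** conj_mat V) \<le> L (adj U ** S ** conj_mat U)"
    by (elim bexE) simp
  have max: "L (adj V ** S ** conj_mat V) \<le> L (adj U ** S ** conj_mat U)" if "unitary V" for V
    using max' that by simp
  define N where "N = adj U ** S ** conj_mat U"
  have N: "transpose N = N"
    unfolding N_def by (simp add: transpose_mult adj_conj_mat S matrix_mul_assoc)
  define F where "F Z = L (cayley (skew_of Z) ** N ** transpose (cayley (skew_of Z)))" for Z
  have cay0: "cayley (skew_of (0 :: complex^'n^'n)) =
      mat 1" "matrix_inv (mat 1 + skew_of (0 :: complex^'n^'n)) = mat 1"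
    using matrix_inv_unique[of "mat 1 :: complex^'n^'n" "mat 1"]
        by (simp_all add: linear_0[OF linear_skew_of] cayley_def)
  \<comment> \<open>Congruence of \<open>N\<close> by \<open>W\<close> amounts to replacing the
    maximizer \<open>U\<close> by \<open>U ** adj W\<close>.\<close>
  have "F Z \<le> F 0" for Z
  proof -
    let ?W = "cayley (skew_of Z)"
    have "unitary (U ** adj ?W)"
      using U by (intro unitary_mult unitary_adj cayley_unitary antiherm_skew_of)
    from max[OF this] show ?thesis
      unfolding F_def N_def cay0 adj_mult conj_mat_mult adj_conj_mat adj_adj
          by (simp add: matrix_mul_assoc transpose_mat)
  qed
  moreover have "(F has_derivative (\<lambda>H. L (cayley_velocity 0 H ** N + N **
      transpose (cayley_velocity 0 H)))) (at 0)"
  proof -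
    have "((\<lambda>Z. N) has_derivative (\<lambda>H. 0)) (at 0)" by simp
    from congruence_has_derivative[OF this]
    have "((\<lambda>Z. cayley (skew_of Z) ** N ** transpose (cayley (skew_of Z))) has_derivative
        (\<lambda>H. cayley_velocity 0 H ** N + N ** transpose (cayley_velocity 0 H))) (at 0)"
      unfolding cay0 by (simp add: transpose_mat)
    then show ?thesis unfolding F_def
      using linL linear_conv_bounded_linear bounded_linear.has_derivative by blast
  qed
  ultimately have "(\<lambda>H. L (cayley_velocity 0 H ** N + N ** transpose (cayley_velocity 0 H))) = (\<lambda>v. 0)"
    using differential_zero_maxmin[of 0 UNIV F] by blast
  then have crit0: "L (cayley_velocity 0 H ** N + N ** transpose (cayley_velocity 0 H)) = 0" for H
      by metis
  have critical: "L (skew_of H ** N + N ** transpose (skew_of H)) = 0" for H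
  proof -
    have "cayley_velocity 0 H = (-2) *\<^sub>R skew_of H" unfolding cayley_velocity_def cay0 by simp
    moreover have "transpose ((-2) *\<^sub>R skew_of H) = (-2) *\<^sub>R transpose (skew_of H)"
      by (rule linear_cmul[OF linear_transpose])
    ultimately have "L ((-2) *\<^sub>R (skew_of H ** N + N ** transpose (skew_of H))) = 0"
      using crit0[of H] by (simp only: scaleR_matrix_mult scaleR_add_right)
    then show ?thesis unfolding linear_cmul[OF linL] by simp
  qed
  have off: "N $ i $ j = 0" if ij: "rk j < rk i" for i j
  proof -
    have ne: "i \<noteq> j" using ij by auto
    have sym: "N $ j $ i = N $ i $ j" using N by (metis transpose_component)
    \<comment> \<open>In the direction of the generator with entry \<open>z\<close> at
      \<open>(i, j)\<close>, only the diagonal entries \<open>i\<close> and \<open>j\<close> of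
      \<open>N\<close> change to first order.\<close>
    have gen: "c i * Re (z * N $ i $ j) = c j * Re (cnj z * N $ i $ j)" for z
    proof -
      define H where "H = (\<chi> k l. if k = i \<and> l = j then z else 0)"
      have A: "skew_of H $ i $ j = z" "skew_of H $ j $ i = - cnj z"
        "\<And>k l. \<not> (k = i \<and> l = j) \<Longrightarrow> \<not> (k = j \<and> l = i) \<Longrightarrow> skew_of H $ k $ l = 0"
        using ij ne by (auto simp: skew_of_def H_def complex_eq_iff)
      define G where "G = skew_of H ** N + N ** transpose (skew_of H)"
      have "G $ i $ i = 2 * z * N $ i $ j"
        unfolding G_def vector_add_component matrix_mult_component
        by (subst (1 2) sum_UNIV_single[of j]) (auto simp: A sym)
      moreover have "G $ j $ j = - 2 * cnj z * N $ i $ j"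
        unfolding G_def vector_add_component matrix_mult_component
        by (subst (1 2) sum_UNIV_single[of i]) (auto simp: A sym ne)
      moreover have "G $ l $ l = 0" if "l \<noteq> i" "l \<noteq> j" for l
        unfolding G_def vector_add_component matrix_mult_component using that by (simp add: A)
      moreover have "L G = c i * Re (G $ i $ i) + c j * Re (G $ j $ j)"
        unfolding L_def using calculation(3) ne by (intro sum_UNIV_two) auto
      moreover have "L G = 0" using critical by (simp add: G_def)
      ultimately have "c i * Re (2 * z * N $ i $ j) + c j * Re (- 2 * cnj z * N $ i $ j) = 0" by simp
      then show ?thesis by (simp add: algebra_simps)
    qed
    \<comment> \<open>Taking \<open>z = \<i>\<close> eliminates the imaginary part through
      \<open>c i + c j\<close>, taking \<open>z = 1\<close> the real part through
      \<open>c i - c j\<close>.\<close>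
    have "c i \<noteq> c j" "c i + c j \<noteq> 0" using ij by (auto simp: c_def)
    moreover have "(c i + c j) * Im (N $ i $ j) = 0"
      using gen[of \<i>] by (simp add: algebra_simps)
    ultimately show ?thesis using gen[of 1] by (auto simp: complex_eq_iff)
  qed
  have "diagonal_matrix N" unfolding diagonal_matrix_def
    using off N rk_less_linear by (metis transpose_component)
  then obtain V s where V: "unitary V" "nonneg_sorted s" "N = V ** diag_mat s ** transpose V"
    using diagonal_congruent_nonneg_sorted by metis
  have "S = U ** N ** transpose U"
    unfolding N_def by (metis U matrix_mul_assoc matrix_mul_lid matrix_mul_rid unitaryD(2,4))
  then have "S = (U ** V) ** diag_mat s ** transpose (U ** V)"
    unfolding V(3) by (simp add: transpose_mult matrix_mul_assoc)
  then show ?thesis using that[OF unitary_mult[OF U V(1)] V(2)] by blast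
qed

section \<open>Comparison of the Jacobians\<close>

text \<open>
  The change of variables theorem is stated for vectors indexed by a well-ordered type; this copy
  of a finite type is one.
\<close>

datatype 'a ranked = Ranked (unranked: 'a)

lemma ranked_UNIV: "(UNIV :: 'a ranked set) = Ranked ` UNIV"
  by (metis UNIV_eq_I rangeI ranked.exhaust)

instance ranked :: (finite) finite
  by standard (simp add: ranked_UNIV)

instantiation ranked :: (finite) wellorder
begin

definition less_eq_ranked :: "'a ranked \<Rightarrow> 'a ranked \<Rightarrow> bool" where
  "less_eq_ranked x y \<longleftrightarrow> rk (unranked x) \<le> rk (unranked y)"

definition less_ranked :: "'a ranked \<Rightarrow> 'a ranked \<Rightarrow> bool" where
  "less_ranked x y \<longleftrightarrow> rk (unranked x) < rk (unranked y)"

instance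
proof
  fix P :: "'a ranked \<Rightarrow> bool" and a
  assume *: "\<And>x. (\<And>y. y < x \<Longrightarrow> P y) \<Longrightarrow> P x"
  show "P a"
    by (induction "rk (unranked a)" arbitrary: a rule: less_induct) (metis * less_ranked_def)
qed (auto simp: less_eq_ranked_def less_ranked_def ranked.expand)

end

lemma sum_ranked: "(\<Sum>x\<in>UNIV. f x) =
    (\<Sum>i\<in>UNIV. \<Sum>j\<in>UNIV. f (Ranked (i, j, True)) + f (Ranked (i, j, False)))"
  for f :: "('n::finite \<times> 'n \<times> bool) ranked \<Rightarrow> 'b::comm_monoid_add"
proof -
  have "(\<Sum>x\<in>UNIV. f x) = (\<Sum>x\<in>UNIV. f (Ranked x))"
    unfolding ranked_UNIV by (subst sum.reindex) (auto simp: inj_on_def)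
  also have "\<dots> = (\<Sum>i\<in>UNIV. \<Sum>j\<in>UNIV. \<Sum>b\<in>UNIV. f (Ranked (i, j, b)))"
    unfolding UNIV_Times_UNIV[symmetric] sum.cartesian_product by simp
  finally show ?thesis by (simp add: UNIV_bool add.commute)
qed

section \<open>Real coordinates and determinants of real-linear maps\<close>

type_synonym 'n coords = "('n \<times> 'n \<times> bool) ranked"

definition vec_of_matrix :: "complex^'n^'n \<Rightarrow> real^'n coords" where
  "vec_of_matrix M = (\<chi> x. case unranked x of (i, j, b) \<Rightarrow> if b then Re (M $ i $ j) else Im (M $ i $ j))"

definition matrix_of_vec :: "real^'n coords \<Rightarrow> complex^'n^'n" where
  "matrix_of_vec x = (\<chi> i j. Complex (x $ Ranked (i, j, True)) (x $ Ranked (i, j, False)))"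

lemma vec_of_matrix_component: "vec_of_matrix M $ Ranked (i, j, b) =
    (if b then Re (M $ i $ j) else Im (M $ i $ j))"
  by (simp add: vec_of_matrix_def)

lemma matrix_of_vec_vec_of_matrix [simp]: "matrix_of_vec (vec_of_matrix M) = M"
  by (simp add: vec_eq_iff matrix_of_vec_def vec_of_matrix_component)

lemma coords_exhaust: obtains i j b where "x = Ranked (i, j, b)"
  by (metis prod_cases3 ranked.exhaust)

lemma vec_of_matrix_matrix_of_vec [simp]: "vec_of_matrix (matrix_of_vec x) = x"
  unfolding vec_eq_iff
proof
  fix y :: "'a coords"
  obtain i j b where "y = Ranked (i, j, b)" by (rule coords_exhaust)
  then show "vec_of_matrix (matrix_of_vec x) $ y = x $ y"
      by (cases b) (simp_all add: vec_of_matrix_component matrix_of_vec_def)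
qed

lemma linear_matrix_of_vec: "linear matrix_of_vec"
  by (auto intro!: linearI simp: vec_eq_iff matrix_of_vec_def complex_eq_iff)

lemma linear_vec_of_matrix: "linear vec_of_matrix"
  by (auto intro!: linearI simp: vec_eq_iff vec_of_matrix_def split: prod.splits)

lemma norm_vec_of_matrix: "norm (vec_of_matrix M) = norm M"
proof -
  have "(norm (vec_of_matrix M))\<^sup>2 = (norm M)\<^sup>2"
    unfolding norm_sq norm_vec_def[of "vec_of_matrix M"] L2_set_def
    by (simp add: sum_nonneg sum_ranked vec_of_matrix_component cmod_power2)
  then show ?thesis by (simp add: power2_eq_iff_nonneg)
qed

lemma norm_matrix_of_vec: "norm (matrix_of_vec x) = norm x"
  by (metis norm_vec_of_matrix vec_of_matrix_matrix_of_vec)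

text \<open>The differentials involve conjugation, so they are linear over the reals only and are
  measured on \<open>2 n^2\<close> real coordinates.\<close>

definition real_det :: "(complex^'n^'n \<Rightarrow> complex^'n^'n) \<Rightarrow> real" where
  "real_det f = det (matrix (vec_of_matrix \<circ> f \<circ> matrix_of_vec))"

lemma real_det_compose:
  assumes "linear f" "linear g"
  shows "real_det (f \<circ> g) = real_det f * real_det g"
proof -
  have "vec_of_matrix \<circ> (f \<circ> g) \<circ> matrix_of_vec =
      (vec_of_matrix \<circ> f \<circ> matrix_of_vec) \<circ> (vec_of_matrix \<circ> g \<circ> matrix_of_vec)"
    by (simp add: fun_eq_iff)
  moreover have "linear (vec_of_matrix \<circ> f \<circ> matrix_of_vec)" "linear (vec_of_matrix \<circ> g \<circ>
      matrix_of_vec)"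
    using assms by (auto intro!: linear_compose linear_vec_of_matrix linear_matrix_of_vec)
  ultimately show ?thesis unfolding real_det_def by (simp add: matrix_compose det_mul)
qed

lemma real_det_isometry:
  assumes "linear f" "\<And>M. norm (f M) = norm M"
  shows "\<bar>real_det f\<bar> = 1"
proof -
  have "linear (vec_of_matrix \<circ> f \<circ> matrix_of_vec)"
    using assms by (auto intro!: linear_compose linear_vec_of_matrix linear_matrix_of_vec)
  then have "orthogonal_transformation (vec_of_matrix \<circ> f \<circ> matrix_of_vec)"
    unfolding orthogonal_transformation by (simp add: norm_vec_of_matrix norm_matrix_of_vec assms(2))
  then show ?thesis unfolding real_det_def by simp
qed

lemma matrix_of_vec_axis:
  "matrix_of_vec (axis (Ranked (k, l, b)) 1) $ i $ j = (if i = k \<and> j =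
      l then (if b then 1 else \<i>) else 0)"
  by (auto simp: matrix_of_vec_def axis_def complex_eq_iff)

text \<open>Evaluated on basis matrices, \<open>g\<close> preserves each position, while
  \<open>f\<close> differs from it only by contributions from positions of strictly lower level
  \<open>w\<close>. Both real matrices are thus block triangular with the same diagonal
  blocks.\<close>

lemma real_det_block_triangular:
  fixes f g :: "complex^'n^'n \<Rightarrow> complex^'n^'n" and w :: "'n \<Rightarrow> 'n \<Rightarrow> nat"
  assumes fg: "\<And>H i j. (\<And>k l. w k l < w i j \<Longrightarrow> H $ k $ l = 0) \<Longrightarrow> f H $ i $ j = g H $ i $ j"
    and g: "\<And>H i j. H $ i $ j = 0 \<Longrightarrow> g H $ i $ j = 0"
  shows "real_det f = real_det g"
proof -
  let ?w = "\<lambda>x. case unranked x of (i, j, b) \<Rightarrow> w i j"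
  have m: "matrix (vec_of_matrix \<circ> h \<circ> matrix_of_vec) $ x $ y =
      vec_of_matrix (h (matrix_of_vec (axis y 1))) $ x"
    for h :: "complex^'n^'n \<Rightarrow> complex^'n^'n" and x y by (simp add: matrix_def)
  have 1: "matrix (vec_of_matrix \<circ> f \<circ> matrix_of_vec) $ x $ y =
      matrix (vec_of_matrix \<circ> g \<circ> matrix_of_vec) $ x $ y" if "?w x \<le> ?w y" for x y
  proof -
    obtain i j b where x: "x = Ranked (i, j, b)" by (rule coords_exhaust)
    obtain k l c where y: "y = Ranked (k, l, c)" by (rule coords_exhaust)
    have "f (matrix_of_vec (axis y 1)) $ i $ j = g (matrix_of_vec (axis y 1)) $ i $ j"
      using that by (intro fg) (auto simp: x y matrix_of_vec_axis)
    then show ?thesis unfolding m by (simp add: x vec_of_matrix_component)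
  qed
  have 2: "matrix (vec_of_matrix \<circ> g \<circ> matrix_of_vec) $ x $ y = 0" if "?w x < ?w y" for x y
  proof -
    obtain i j b where x: "x = Ranked (i, j, b)" by (rule coords_exhaust)
    obtain k l c where y: "y = Ranked (k, l, c)" by (rule coords_exhaust)
    have "g (matrix_of_vec (axis y 1)) $ i $ j = 0"
      using that by (intro g) (auto simp: x y matrix_of_vec_axis)
    then show ?thesis unfolding m by (simp add: x vec_of_matrix_component)
  qed
  show ?thesis unfolding real_det_def
    by (rule det_block_triangular_eq[where w = ?w]) (use 1 2 in auto)
qed

lemma card_pairs: "card {(i, j). rk (j :: 'n) < rk (i :: 'n::finite)} * 2 = CARD('n) * (CARD('n) - 1)"
proof -
  let ?A = "{(i, j). rk (j :: 'n) < rk (i :: 'n)}"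
  let ?B = "{(i, j). rk (i :: 'n) < rk (j :: 'n)}"
  let ?C = "{(i, j). i = (j :: 'n)}"
  have "?B = prod.swap ` ?A" by force
  moreover have "inj_on prod.swap ?A" by (auto simp: inj_on_def)
  then have "card (prod.swap ` ?A) = card ?A" by (rule card_image)
  ultimately have "card ?B = card ?A" by simp
  moreover have "card ?C = CARD('n)"
  proof -
    have "?C = (\<lambda>i. (i, i)) ` UNIV" by auto
    then show ?thesis by (simp add: card_image inj_on_def)
  qed
  moreover have "card (UNIV :: ('n \<times> 'n) set) = card ?A + card ?B + card ?C"
  proof -
    have "UNIV = (?A \<union> ?B) \<union> ?C" using rk_less_linear by auto
    moreover have "card ((?A \<union> ?B) \<union> ?C) = card (?A \<union> ?B) + card ?C"
      by (intro card_Un_disjoint) (auto intro: finite_subset[OF subset_UNIV finite])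
    moreover have "card (?A \<union> ?B) = card ?A + card ?B"
      by (intro card_Un_disjoint) (auto intro: finite_subset[OF subset_UNIV finite])
    ultimately show ?thesis by metis
  qed
  ultimately have "2 * card ?A + CARD('n) = CARD('n) * CARD('n)" by (simp add: card_prod)
  then show ?thesis by (simp add: diff_mult_distrib2)
qed

definition scale_lower :: "complex^'n^'n \<Rightarrow> complex^'n^'n" where
  "scale_lower Y = (\<chi> i j. if rk j < rk i then sqrt 2 *\<^sub>R Y $ i $ j else Y $ i $ j)"

lemma linear_scale_lower: "linear scale_lower"
  by (auto intro!: linearI simp: vec_eq_iff scale_lower_def scaleR_add_right)

text \<open>The origin of the constant of the theorem: each complex entry below the diagonal is two
  real coordinates and contributes \<open>sqrt 2 * sqrt 2 = 2\<close>.\<close>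

lemma real_det_scale_lower: "real_det (scale_lower :: complex^'n^'n \<Rightarrow> _) =
    2 powr (real CARD('n) * (real CARD('n) - 1) / 2)"
proof -
  let ?M = "matrix (vec_of_matrix \<circ> scale_lower \<circ> matrix_of_vec) :: real^'n coords^'n coords"
  have M: "?M $ Ranked (i, j, b) $ Ranked (k, l, c) =
      (if i = k \<and> j = l \<and> b = c then if rk j < rk i then sqrt 2 else 1 else 0)"
          for i j k l :: 'n and b c
    by (auto simp: matrix_def vec_of_matrix_component scale_lower_def matrix_of_vec_axis)
  have "?M $ x $ y = 0" if "x \<noteq> y" for x y
    by (rule coords_exhaust[of x], rule coords_exhaust[of y]) (use that in \<open>auto simp: M\<close>)
  then have "det ?M = (\<Prod>x\<in>UNIV. ?M $ x $ x)" by (rule det_diagonal)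
  also have "\<dots> = (\<Prod>x\<in>UNIV. ?M $ Ranked x $ Ranked x)"
    unfolding ranked_UNIV by (subst prod.reindex) (auto simp: inj_on_def)
  also have "\<dots> = (\<Prod>i\<in>UNIV. \<Prod>j\<in>UNIV. \<Prod>b\<in>UNIV. ?M $ Ranked (i, j, b) $ Ranked (i, j, b))"
    unfolding UNIV_Times_UNIV[symmetric] prod.cartesian_product by simp
  also have "\<dots> = (\<Prod>i\<in>UNIV. \<Prod>j\<in>UNIV. if rk (j :: 'n) < rk (i :: 'n) then 2 else 1)"
    by (auto simp: UNIV_bool M intro!: prod.cong)
  also have "\<dots> = (\<Prod>(i, j)\<in>(UNIV :: ('n \<times> 'n) set). if rk j < rk i then 2 else 1)"
    unfolding UNIV_Times_UNIV[symmetric] prod.cartesian_product by simp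
  also have "\<dots> = (\<Prod>x\<in>(UNIV :: ('n \<times> 'n) set).
      if x \<in> {(i, j). rk (j :: 'n) < rk (i :: 'n)} then 2 else 1)"
    by (intro prod.cong refl) auto
  also have "\<dots> = 2 ^ card {(i, j). rk (j :: 'n) < rk (i :: 'n)}"
    by (subst prod.If_cases) auto
  also have "\<dots> = 2 powr real (card {(i, j). rk (j :: 'n) < rk (i :: 'n)})"
    by (simp add: powr_realpow)
  also have "real (card {(i, j). rk (j :: 'n) < rk (i :: 'n)}) =
      real CARD('n) * (real CARD('n) - 1) / 2"
  proof -
    have "real (card {(i, j). rk (j :: 'n) < rk (i :: 'n)} * 2) = real (CARD('n) * (CARD('n) - 1))"
      by (simp only: card_pairs)
    moreover have "1 \<le> CARD('n)" by simp
    ultimately show ?thesis by (simp add: of_nat_diff)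
  qed
  finally show ?thesis unfolding real_det_def .
qed

section \<open>The two parametrizations and their derivatives\<close>

definition schur_map :: "complex^'n^'n \<Rightarrow> complex^'n^'n" where
  "schur_map Z = cayley (skew_of Z) ** upper_of Z ** transpose (cayley (skew_of Z))"

text \<open>
  The factor \<open>sqrt 2\<close> makes the coding of a symmetric and a strictly upper triangular matrix
  isometric.
\<close>

definition encode_pair :: "complex^'n^'n \<Rightarrow> complex^'n^'n \<Rightarrow> complex^'n^'n" where
  "encode_pair S R = (\<chi> i j. if rk i < rk j then R $ i $ j else
      if i = j then S $ i $ i else sqrt 2 *\<^sub>R S $ i $ j)"

text \<open>Of its second argument \<open>encode_pair\<close> reads only the strict upper triangle,
  so \<open>Z\<close> itself can stand for \<open>R\<close>.\<close>

definition takagi_map :: "complex^'n^'n \<Rightarrow> complex^'n^'n" where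
  "takagi_map Z = encode_pair (cayley (skew_of Z) ** diag_mat (diag_of Z) **
      transpose (cayley (skew_of Z))) Z"

definition schur_map_deriv :: "complex^'n^'n \<Rightarrow> complex^'n^'n \<Rightarrow> complex^'n^'n" where
  "schur_map_deriv Z H = cayley (skew_of Z) ** (cayley_velocity Z H ** upper_of Z + upper_of Z **
      transpose (cayley_velocity Z H) + upper_of H) ** transpose (cayley (skew_of Z))"

definition takagi_map_deriv :: "complex^'n^'n \<Rightarrow> complex^'n^'n \<Rightarrow> complex^'n^'n" where
  "takagi_map_deriv Z H = encode_pair (cayley (skew_of Z) ** (cayley_velocity Z H **
      diag_mat (diag_of Z) + diag_mat (diag_of Z) ** transpose (cayley_velocity Z H) +
      diag_mat (diag_of H)) **
     transpose (cayley (skew_of Z))) H"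

lemma encode_pair_cong: "(\<And>i j. rk i < rk j \<Longrightarrow> R $ i $ j = R' $ i $ j) \<Longrightarrow> encode_pair S R =
    encode_pair S R'"
  by (simp add: encode_pair_def vec_eq_iff)

lemma linear_encode_pair: "linear (\<lambda>(S, R). encode_pair S R)"
  by (auto intro!: linearI simp: vec_eq_iff encode_pair_def scaleR_add_right)

lemma schur_map_has_derivative: "(schur_map has_derivative schur_map_deriv Z) (at Z)"
  unfolding schur_map_def[abs_def] schur_map_deriv_def[abs_def]
  by (intro congruence_has_derivative linear_has_derivative linear_upper_of)

lemma takagi_map_has_derivative: "(takagi_map has_derivative takagi_map_deriv Z) (at Z)"
proof -
  have "((\<lambda>Z. (\<lambda>(S, R). encode_pair S R) (cayley (skew_of Z) ** diag_mat (diag_of Z) **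
      transpose (cayley (skew_of Z)), Z)) has_derivative
    (\<lambda>H. (\<lambda>(S, R). encode_pair S R) (cayley (skew_of Z) ** (cayley_velocity Z H **
        diag_mat (diag_of Z) + diag_mat (diag_of Z) ** transpose (cayley_velocity Z H) +
        diag_mat (diag_of H)) **
     transpose (cayley (skew_of Z)), H))) (at Z)"
    using linear_encode_pair[unfolded linear_conv_bounded_linear]
    by (rule bounded_linear.has_derivative)
      (intro has_derivative_Pair has_derivative_ident congruence_has_derivative
          linear_has_derivative linear_diag_mat_diag_of)
  then show ?thesis unfolding takagi_map_def[abs_def] takagi_map_deriv_def[abs_def] by simp
qed

text \<open>Changes coordinates from the direction \<open>H\<close> to the frame velocity, leaving
  the triangular part alone. It is a factor of both derivatives, so its determinant cancels in the
  comparison and is never computed.\<close>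

definition velocity_code :: "complex^'n^'n \<Rightarrow> complex^'n^'n \<Rightarrow> complex^'n^'n" where
  "velocity_code Z H = (\<chi> i j. if rk j < rk i then cayley_velocity Z H $ i $ j
     else if i = j then Complex (Re (H $ i $ i)) (Im (cayley_velocity Z H $ i $ i)) else H $ i $ j)"

lemma linear_velocity_code: "linear (velocity_code Z)"
  by (auto intro!: linearI simp: vec_eq_iff velocity_code_def complex_eq_iff linear_add[OF
      linear_cayley_velocity] linear_cmul[OF linear_cayley_velocity])

lemma skew_of_velocity_code: "skew_of (velocity_code Z H) = cayley_velocity Z H"
proof -
  have A: "- cnj (cayley_velocity Z H $ j $ i) = cayley_velocity Z H $ i $ j" for i j
    using antiherm_cayley_velocity[of Z H]
        by (metis adj_component antiherm_def minus_minus vector_uminus_component)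
  have re: "Re (cayley_velocity Z H $ i $ i) = 0" for i using arg_cong[OF A[of i i], of Re] by simp
  have "skew_of (velocity_code Z H) $ i $ j = cayley_velocity Z H $ i $ j" for i j
    using rk_less_linear[of i j] A[of i j] re[of i]
        by (auto simp: skew_of_def velocity_code_def complex_eq_iff)
  then show ?thesis by (simp add: vec_eq_iff)
qed

lemma upper_of_velocity_code: "upper_of (velocity_code Z H) = upper_of H"
  by (auto simp: vec_eq_iff upper_of_def velocity_code_def)

lemma diag_of_velocity_code: "diag_of (velocity_code Z H) = diag_of H"
  by (auto simp: diag_of_def velocity_code_def)

definition schur_differential :: "complex^'n^'n \<Rightarrow> complex^'n^'n \<Rightarrow> complex^'n^'n" where
  "schur_differential T H = skew_of H ** T + T ** transpose (skew_of H) + upper_of H"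

definition encoded_differential :: "('n \<Rightarrow> real) \<Rightarrow> complex^'n^'n \<Rightarrow> complex^'n^'n" where
  "encoded_differential s H =
      encode_pair (skew_of H ** diag_mat s + diag_mat s ** transpose (skew_of H) +
      diag_mat (diag_of H)) H"

text \<open>This is \<open>encoded_differential\<close> without its factors \<open>sqrt 2\<close>,
  which are split off as \<open>scale_lower\<close>; only then can it have the same determinant as
  \<open>schur_differential\<close>.\<close>

definition takagi_differential :: "('n \<Rightarrow> real) \<Rightarrow> complex^'n^'n \<Rightarrow> complex^'n^'n" where
  "takagi_differential s H = (\<chi> i j. if rk i < rk j then H $ i $ j
     else (skew_of H ** diag_mat s + diag_mat s ** transpose (skew_of H) +
         diag_mat (diag_of H)) $ i $ j)"

lemma linear_schur_differential: "linear (schur_differential T)"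
  by (auto intro!: linearI simp: schur_differential_def linear_add[OF linear_skew_of]
      linear_cmul[OF linear_skew_of]
      linear_add[OF linear_upper_of] linear_cmul[OF linear_upper_of]
      linear_add[OF linear_transpose] linear_cmul[OF linear_transpose] matrix_mult_simps
          scaleR_matrix_mult scaleR_add_right)

lemma linear_takagi_differential: "linear (takagi_differential s)"
  by (auto intro!: linearI simp: takagi_differential_def vec_eq_iff linear_add[OF linear_skew_of]
      linear_cmul[OF linear_skew_of]
      linear_add[OF linear_diag_mat_diag_of] linear_cmul[OF linear_diag_mat_diag_of]
      linear_add[OF linear_transpose] linear_cmul[OF linear_transpose] matrix_mult_simps
          scaleR_matrix_mult scaleR_add_right)

lemma encoded_differential_eq: "encoded_differential s = scale_lower \<circ> takagi_differential s"
  using rk_less_linear by (fastforce simp: fun_eq_iff vec_eq_iff encoded_differential_def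
      takagi_differential_def scale_lower_def encode_pair_def)

lemma takagi_differential_component:
  "takagi_differential s H $ i $ j =
      (if rk i < rk j then H $ i $ j else skew_of H $ i $ j * s j + s i * skew_of H $ j $ i +
     (if i = j then complex_of_real (Re (H $ i $ i)) else 0))"
  by (simp add: takagi_differential_def diag_mat_left diag_mat_right) (simp add: diag_mat_def
      diag_of_def)

text \<open>On or below the diagonal, an entry of \<open>T\<close> above its diagonal meets only
  entries of the skew part that lie farther from the diagonal. Above the diagonal, the free entry of
  \<open>H\<close> absorbs everything the skew part contributes.\<close>

lemma real_det_schur_differential:
  fixes T :: "complex^'n^'n"
  assumes T: "upper T" "\<And>i. T $ i $ i = complex_of_real (s i)"
  shows "real_det (schur_differential T) = real_det (takagi_differential s)"
proof -
  obtain m where "\<forall>x\<in>range (rk :: 'n \<Rightarrow> nat). x < m"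
    using finite_nat_set_iff_bounded[of "range (rk :: 'n \<Rightarrow> nat)"] finite_imageI[OF finite[of UNIV]]
    by meson
  then have m: "rk j < m" for j :: 'n by (meson rangeI)
  \<comment> \<open>Levels rise from the lower corner to \<open>m\<close> on the diagonal; all
    positions above the diagonal share the top level \<open>m + 1\<close>, where the whole skew part
    counts as lower.\<close>
  define w :: "'n \<Rightarrow> 'n \<Rightarrow> nat" where "w i j = (if rk i < rk j then m + 1 else m + rk j - rk i)" for i j
  show ?thesis
  proof (rule real_det_block_triangular[where w = w])
    fix H :: "complex^'n^'n" and i j
    assume H: "\<And>k l. w k l < w i j \<Longrightarrow> H $ k $ l = 0"
    show "schur_differential T H $ i $ j = takagi_differential s H $ i $ j"
    proof (cases "rk i < rk j")
      case True
      have H0: "H $ k $ l = 0" if "\<not> rk k < rk l" for k l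
        using that True m[of k] by (intro H) (auto simp: w_def)
      have "skew_of H = 0"
        using H0 by (auto simp: vec_eq_iff skew_of_def complex_eq_iff)
      then have "schur_differential T H = upper_of H"
          by (simp add: schur_differential_def linear_0[OF linear_transpose])
      then show ?thesis using True by (simp add: takagi_differential_def upper_of_def)
    next
      case False
      then have ji: "rk j \<le> rk i" by simp
      have A: "skew_of H $ k $ l = 0" if "rk l < rk k" "rk i + rk l < rk k + rk j" for k l
      proof -
        have "H $ k $ l = 0"
          using that False m[of k] m[of i] by (intro H) (auto simp: w_def)
        then show ?thesis using that by (simp add: skew_of_def)
      qed
      \<comment> \<open>The transposed factor reads entries above the diagonal, which are determined
        by their mirror images below.\<close>
      have A': "skew_of H $ l $ k = 0" if "rk l < rk k" "rk i + rk l < rk k + rk j" for k l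
        using A[OF that] that by (auto simp: skew_of_def complex_eq_iff)
      have "(skew_of H ** T) $ i $ j = skew_of H $ i $ j * s j"
        unfolding matrix_mult_component
      proof (subst sum_UNIV_single[of j])
        fix k assume "k \<noteq> j"
        then show "skew_of H $ i $ k * T $ k $ j = 0"
          using T(1) A[of k i] ji rk_less_linear[of k j] by (auto simp: upper_def)
      qed (simp add: T(2))
      moreover have "(T ** transpose (skew_of H)) $ i $ j = s i * skew_of H $ j $ i"
        unfolding matrix_mult_component
      proof (subst sum_UNIV_single[of i])
        fix k assume "k \<noteq> i"
        then show "T $ i $ k * transpose (skew_of H) $ k $ j = 0"
          using T(1) A'[of j k] ji rk_less_linear[of k i] by (auto simp: upper_def)
      qed (simp add: T(2))
      moreover have "upper_of H $ i $ j = diag_mat (diag_of H) $ i $ j"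
        using False by (auto simp: upper_of_def diag_mat_def diag_of_def)
      ultimately show ?thesis using False
        by (simp add: schur_differential_def takagi_differential_component diag_mat_def diag_of_def)
    qed
  next
    fix H :: "complex^'n^'n" and i j
    assume H: "H $ i $ j = 0"
    show "takagi_differential s H $ i $ j = 0"
      using H rk_less_linear[of i j]
          by (auto simp: takagi_differential_component skew_of_def complex_eq_iff)
  qed
qed

section \<open>Isometries of the coded pairs and factorization of the derivatives\<close>

definition symmetric_of :: "complex^'n^'n \<Rightarrow> complex^'n^'n" where
  "symmetric_of Y = (\<chi> i j. if rk j < rk i then (1 / sqrt 2) *\<^sub>R Y $ i $ j else if i = j then Y $ i $ i
     else (1 / sqrt 2) *\<^sub>R Y $ j $ i)"

lemma linear_symmetric_of: "linear symmetric_of"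
  by (auto intro!: linearI simp: vec_eq_iff symmetric_of_def scaleR_add_right)

lemma symmetric_of_encode_pair:
  assumes "transpose S = S"
  shows "symmetric_of (encode_pair S R) = S"
proof -
  have "S $ j $ i = S $ i $ j" for i j using assms by (metis transpose_component)
  then show ?thesis using rk_less_linear by (auto simp: vec_eq_iff symmetric_of_def encode_pair_def)
qed

lemma symmetric_of_sym: "transpose (symmetric_of Y) = symmetric_of Y"
  using rk_less_linear by (auto simp: vec_eq_iff symmetric_of_def)

lemma encode_pair_symmetric_of: "encode_pair (symmetric_of Y) Y = Y"
  using rk_less_linear by (auto simp: vec_eq_iff symmetric_of_def encode_pair_def)

lemma norm_encode_pair:
  fixes S R :: "complex^'n^'n"
  assumes "transpose S = S"
  shows "(norm (encode_pair S R))\<^sup>2 = (norm S)\<^sup>2 + (\<Sum>i\<in>UNIV. \<Sum>j\<in>UNIV.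
      if rk i < rk j then (cmod (R $ i $ j))\<^sup>2 else 0)"
proof -
  have sym: "S $ j $ i = S $ i $ j" for i j using assms by (metis transpose_component)
  define a where "a i j = (if rk i < rk j then (cmod (S $ i $ j))\<^sup>2 else 0)" for i j
  define b where "b i j = (if i = j then (cmod (S $ i $ j))\<^sup>2 else 0)" for i j
  define r where "r i j = (if rk i < rk j then (cmod (R $ i $ j))\<^sup>2 else 0)" for i j
  have aa: "(\<Sum>i\<in>UNIV. \<Sum>j\<in>UNIV. a j i) = (\<Sum>i\<in>UNIV. \<Sum>j\<in>UNIV. a i j)" by (rule sum.swap)
  have "(cmod (encode_pair S R $ i $ j))\<^sup>2 = r i j + b i j + 2 * a j i" for i j
    using rk_less_linear[of i j]
    by (auto simp: encode_pair_def r_def a_def b_def sym[of i j] power_mult_distrib)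
  then have "(norm (encode_pair S R))\<^sup>2 = (\<Sum>i\<in>UNIV. \<Sum>j\<in>UNIV. r i j + b i j + 2 * a j i)"
    unfolding norm_sq by simp
  also have "\<dots> = (\<Sum>i\<in>UNIV. \<Sum>j\<in>UNIV. a i j + b i j + a j i) + (\<Sum>i\<in>UNIV. \<Sum>j\<in>UNIV. r i j)"
    using aa by (simp add: sum.distrib sum_distrib_left[symmetric])
  also have "(\<Sum>i\<in>UNIV. \<Sum>j\<in>UNIV. a i j + b i j + a j i) = (norm S)\<^sup>2"
    unfolding norm_sq
    by (intro sum.cong refl) (use rk_less_linear in \<open>fastforce simp: a_def b_def sym\<close>)
  finally show ?thesis by (simp add: r_def)
qed

text \<open>The action of \<open>U\<close> on pairs in coded form: the symmetric part is congruently
  transformed, the triangular part stays. It plays the role that congruence by \<open>U\<close> has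
  for \<open>schur_map\<close>.\<close>

definition encoded_congruence :: "complex^'n^'n \<Rightarrow> complex^'n^'n \<Rightarrow> complex^'n^'n" where
  "encoded_congruence U Y = encode_pair (U ** symmetric_of Y ** transpose U) Y"

lemma linear_encoded_congruence: "linear (encoded_congruence U)"
proof -
  have "encoded_congruence U =
      (\<lambda>(S, R). encode_pair S R) \<circ> (\<lambda>Y. (U ** symmetric_of Y ** transpose U, Y))"
    by (simp add: fun_eq_iff encoded_congruence_def)
  have "linear (\<lambda>Y. (U ** symmetric_of Y ** transpose U, Y))"
    by (auto intro!: linearI simp: linear_add[OF linear_symmetric_of] linear_cmul[OF
        linear_symmetric_of] matrix_mult_simps scaleR_matrix_mult)
  from linear_compose[OF this linear_encode_pair] \<open>encoded_congruence U = _\<close> show ?thesis by simp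
qed

lemma congruence_sym: "transpose S = S \<Longrightarrow> transpose (U ** S ** transpose U) =
    U ** S ** transpose (U :: complex^'n^'n)"
  by (simp add: transpose_mult matrix_mul_assoc)

lemma norm_encoded_congruence: "unitary U \<Longrightarrow> norm (encoded_congruence U Y) = norm Y"
proof -
  assume U: "unitary U"
  have "(norm (encoded_congruence U Y))\<^sup>2 = (norm (encode_pair (symmetric_of Y) Y))\<^sup>2"
    unfolding encoded_congruence_def norm_encode_pair[OF congruence_sym[OF symmetric_of_sym]]
        norm_encode_pair[OF symmetric_of_sym] norm_congruence[OF U] ..
  then show ?thesis by (simp add: encode_pair_symmetric_of power2_eq_iff_nonneg)
qed

text \<open>Three stages: pass to frame velocities, differentiate at the frame, and transport back
  isometrically. The derivative of \<open>takagi_map\<close> splits in the same way, with the same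
  first stage.\<close>

lemma schur_map_deriv_eq: "schur_map_deriv Z =
    (\<lambda>Y. cayley (skew_of Z) ** Y ** transpose (cayley (skew_of Z))) \<circ>
    schur_differential (upper_of Z) \<circ> velocity_code Z"
  by (simp add: fun_eq_iff schur_map_deriv_def schur_differential_def skew_of_velocity_code
      upper_of_velocity_code)

lemma diag_mat_sym: "transpose (diag_mat s) = diag_mat s"
  by (auto simp: vec_eq_iff diag_mat_def)

lemma takagi_map_deriv_eq: "takagi_map_deriv Z =
    encoded_congruence (cayley (skew_of Z)) \<circ> (scale_lower \<circ> takagi_differential (diag_of Z)) \<circ>
    velocity_code Z"
proof -
  have "takagi_map_deriv Z H =
      encoded_congruence (cayley (skew_of Z)) (encoded_differential (diag_of Z) (velocity_code Z
      H))" for H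
  proof -
    let ?S = "cayley_velocity Z H ** diag_mat (diag_of Z) + diag_mat (diag_of Z) **
        transpose (cayley_velocity Z H) + diag_mat (diag_of H)"
    have "transpose ?S = ?S"
      by (simp add: linear_add[OF linear_transpose] transpose_mult diag_mat_sym add.commute)
    then have "symmetric_of (encoded_differential (diag_of Z) (velocity_code Z H)) = ?S"
      unfolding encoded_differential_def skew_of_velocity_code diag_of_velocity_code
          by (rule symmetric_of_encode_pair)
    then have "encoded_congruence (cayley (skew_of Z)) (encoded_differential (diag_of Z)
        (velocity_code Z H)) =
        encode_pair (cayley (skew_of Z) ** ?S **
            transpose (cayley (skew_of Z))) (encoded_differential (diag_of Z) (velocity_code Z H))"
      by (simp only: encoded_congruence_def)
    also have "\<dots> = encode_pair (cayley (skew_of Z) ** ?S ** transpose (cayley (skew_of Z))) H"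
      by (rule encode_pair_cong) (auto simp: encoded_differential_def velocity_code_def encode_pair_def)
    finally show ?thesis by (simp add: takagi_map_deriv_def)
  qed
  then show ?thesis by (simp add: fun_eq_iff encoded_differential_eq)
qed

lemma linear_congruence: "linear (\<lambda>Y. U ** Y ** transpose (U :: complex^'n^'n))"
  by (auto intro!: linearI simp: matrix_mult_simps scaleR_matrix_mult)

lemma real_det_schur_map_deriv: "\<bar>real_det (schur_map_deriv Z)\<bar> =
    \<bar>real_det (takagi_differential (diag_of Z))\<bar> * \<bar>real_det (velocity_code Z)\<bar>"
proof -
  have U: "unitary (cayley (skew_of Z))" by (simp add: cayley_unitary antiherm_skew_of)
  have "\<bar>real_det (\<lambda>Y. cayley (skew_of Z) ** Y ** transpose (cayley (skew_of Z)))\<bar> = 1"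
    by (rule real_det_isometry[OF linear_congruence norm_congruence[OF U]])
  then show ?thesis
    unfolding schur_map_deriv_eq
    by (simp add: real_det_compose linear_compose linear_congruence linear_schur_differential
        linear_velocity_code abs_mult
        real_det_schur_differential[OF upper_upper_of upper_of_diag])
qed

text \<open>The last stages are isometries, the first is shared and the middle determinants agree,
  so \<open>scale_lower\<close> alone survives.\<close>

lemma real_det_takagi_map_deriv: "\<bar>real_det (takagi_map_deriv (Z :: complex^'n^'n))\<bar> =
    2 powr (real CARD('n) * (real CARD('n) - 1) / 2) * \<bar>real_det (schur_map_deriv Z)\<bar>"
proof -
  have U: "unitary (cayley (skew_of Z))" by (simp add: cayley_unitary antiherm_skew_of)
  have "\<bar>real_det (encoded_congruence (cayley (skew_of Z)))\<bar> = 1"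
    by (rule real_det_isometry[OF linear_encoded_congruence norm_encoded_congruence[OF U]])
  then show ?thesis
    unfolding takagi_map_deriv_eq real_det_schur_map_deriv
    by (simp add: real_det_compose linear_compose linear_encoded_congruence
        linear_takagi_differential linear_scale_lower linear_velocity_code abs_mult
        real_det_scale_lower)
qed

text \<open>The kernel contains the infinitesimal stabilizer of the diagonal matrix under
  congruence: a phase rotation at a zero value, a real plane rotation between equal values.\<close>

lemma real_det_takagi_differential_critical:
  fixes s :: "'n::finite \<Rightarrow> real"
  assumes "s i = 0 \<or> (i \<noteq> j \<and> s i = s j)"
  shows "real_det (takagi_differential s) = 0"
proof -
  have "\<exists>H. H \<noteq> 0 \<and> takagi_differential s H = 0"
  proof (cases "s i = 0")
    case True
    define H :: "complex^'n^'n" where "H = (\<chi> k l. if k = i \<and> l = i then \<i> else 0)"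
    have "skew_of H $ k $ l = (if k = i \<and> l = i then \<i> else 0)" for k l
      by (auto simp: skew_of_def H_def complex_eq_iff)
    then have "takagi_differential s H = 0"
      using True by (auto simp: vec_eq_iff takagi_differential_component) (auto simp: H_def)
    moreover have "H \<noteq> 0" by (auto simp: vec_eq_iff H_def)
    ultimately show ?thesis by blast
  next
    case False
    \<comment> \<open>Order the pair so that the generator is stored in the lower triangle, where
      \<open>skew_of\<close> reads it.\<close>
    have "\<exists>i j. rk j < rk i \<and> s i = s j"
      using assms False rk_less_linear[of i j] by metis
    then obtain i j where ij: "rk j < rk i" "s i = s j" by blast
    then have ne: "i \<noteq> j" by auto
    define H :: "complex^'n^'n" where "H = (\<chi> k l. if k = i \<and> l = j then 1 else 0)"
    have A: "skew_of H $ k $ l = (if k = i \<and> l = j then 1 else if k = j \<and> l = i then -1 else 0)" for k l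
      using ij ne by (auto simp: skew_of_def H_def complex_eq_iff)
    have "takagi_differential s H $ k $ l = 0" for k l
      using ij ne by (auto simp: takagi_differential_component A) (auto simp: H_def)
    then have "takagi_differential s H = 0" by (simp add: vec_eq_iff)
    moreover have "H $ i $ j = 1" by (simp add: H_def)
    then have "H \<noteq> 0" by auto
    ultimately show ?thesis by blast
  qed
  then obtain H where H: "H \<noteq> 0" "takagi_differential s H = 0" by blast
  have l: "linear (vec_of_matrix \<circ> takagi_differential s \<circ> matrix_of_vec)"
    by (intro linear_compose linear_takagi_differential linear_vec_of_matrix linear_matrix_of_vec)
  have "(vec_of_matrix \<circ> takagi_differential s \<circ> matrix_of_vec) (vec_of_matrix H) =
      (vec_of_matrix \<circ> takagi_differential s \<circ> matrix_of_vec) 0"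
    by (simp add: H linear_0[OF linear_matrix_of_vec] linear_0[OF linear_takagi_differential])
  moreover have "vec_of_matrix H \<noteq> 0" using H(1)
      by (metis linear_0[OF linear_matrix_of_vec] matrix_of_vec_vec_of_matrix)
  ultimately have "\<not> inj (vec_of_matrix \<circ> takagi_differential s \<circ> matrix_of_vec)" by (metis injD)
  then show ?thesis unfolding real_det_def using det_nz_iff_inj[OF l] by blast
qed

lemma norm_schur_map_takagi_map: "norm (takagi_map Z) = norm (schur_map Z)"
proof -
  have U: "unitary (cayley (skew_of Z))" by (simp add: cayley_unitary antiherm_skew_of)
  have "(norm (takagi_map Z))\<^sup>2 = (norm (encode_pair (diag_mat (diag_of Z)) Z))\<^sup>2"
    unfolding takagi_map_def norm_encode_pair[OF congruence_sym[OF diag_mat_sym]]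
        norm_encode_pair[OF diag_mat_sym] norm_congruence[OF U] ..
  also have "encode_pair (diag_mat (diag_of Z)) Z = upper_of Z"
    using rk_less_linear by (auto simp: vec_eq_iff encode_pair_def diag_mat_def upper_of_def
        diag_of_def)
  finally have "norm (takagi_map Z) = norm (upper_of Z)" by (simp add: power2_eq_iff_nonneg)
  then show ?thesis by (simp add: schur_map_def norm_congruence[OF U])
qed

section \<open>A fundamental domain\<close>

text \<open>A half-space: the first nonzero entry lies in a half-plane that contains exactly one of
  each pair of opposite nonzero numbers.\<close>

definition positive_vec :: "complex^'n \<Rightarrow> bool" where
  "positive_vec u \<longleftrightarrow> (\<exists>i. (\<forall>k. rk k < rk i \<longrightarrow> u $ k = 0) \<and> (0 < Re (u $ i) \<or> Re (u $ i) = 0 \<and>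
      0 < Im (u $ i)))"

lemma positive_vec_uminus:
  fixes u :: "complex^'n"
  assumes "u \<noteq> 0"
  shows "positive_vec (- u) \<longleftrightarrow> \<not> positive_vec u"
proof -
  let ?K = "{k. u $ k \<noteq> 0}"
  have "finite (rk ` ?K)" "rk ` ?K \<noteq> {}" using assms by (auto simp: vec_eq_iff)
  then have "Min (rk ` ?K) \<in> rk ` ?K" by (rule Min_in)
  then obtain m where m: "u $ m \<noteq> 0" "rk m = Min (rk ` ?K)" by (elim imageE) auto
  have 0: "u $ k = 0" if "rk k < rk m" for k
  proof (rule ccontr)
    assume "u $ k \<noteq> 0"
    then have "Min (rk ` ?K) \<le> rk k" by (intro Min_le) auto
    then show False using that m(2) by simp
  qed
  have *: "positive_vec v \<longleftrightarrow> 0 < Re (v $ m) \<or> Re (v $ m) = 0 \<and> 0 < Im (v $ m)"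
      if v: "v = u \<or> v = - u" for v
  proof
    assume "positive_vec v"
    then obtain i where i: "\<forall>k. rk k < rk i \<longrightarrow> v $ k = 0"
      "0 < Re (v $ i) \<or> Re (v $ i) = 0 \<and> 0 < Im (v $ i)" unfolding positive_vec_def by blast
    have "\<not> rk m < rk i" using i(1) m(1) v by auto
    moreover have "\<not> rk i < rk m" using 0[of i] i(2) v by auto
    ultimately have "i = m" using rk_less_linear[of i m] by blast
    then show "0 < Re (v $ m) \<or> Re (v $ m) = 0 \<and> 0 < Im (v $ m)" using i by simp
  next
    assume "0 < Re (v $ m) \<or> Re (v $ m) = 0 \<and> 0 < Im (v $ m)"
    then show "positive_vec v" unfolding positive_vec_def using 0 v by (intro exI[of _ m]) auto
  qed
  show ?thesis using *[of u] *[of "- u"] m(1) by (auto simp: complex_eq_iff)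
qed

definition sign_pattern :: "complex^'n^'n \<Rightarrow> 'n set" where
  "sign_pattern U = {j. positive_vec (column j U)}"

text \<open>Flipping a nonzero column flips its membership, so the pattern distinguishes all
  \<open>2^n\<close> representatives \<open>U ** sign_mat J\<close>.\<close>

lemma sign_pattern_sign_mat:
  assumes "unitary U"
  shows "j \<in> sign_pattern (U ** sign_mat J) \<longleftrightarrow> (j \<in> sign_pattern U) \<noteq> (j \<in> J)"
proof -
  have "column j U \<noteq> 0"
  proof
    assume "column j U = 0"
    then have "U $ k $ j = 0" for k by (auto simp: column_def vec_eq_iff)
    then have "(adj U ** U) $ j $ j = 0" by (simp add: matrix_mult_component)
    then show False using assms by (simp add: unitaryD mat_def)
  qed
  moreover have "column j (U ** sign_mat J) = (if j \<in> J then - column j U else column j U)"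
    by (simp add: vec_eq_iff column_def sign_mat_right)
  ultimately show ?thesis by (simp add: sign_pattern_def positive_vec_uminus)
qed

lemma sign_mat_mult: "sign_mat J ** sign_mat K = sign_mat ((J - K) \<union> (K - J))"
  unfolding vec_eq_iff sign_mat_right by (auto simp: sign_mat_def)

text \<open>
  The unitary factor is unique only up to right multiplication by sign matrices; exactly one
  representative with a Cayley coordinate is canonical.
\<close>

definition canonical :: "complex^'n^'n \<Rightarrow> bool" where
  "canonical U \<longleftrightarrow> (\<forall>J. det (mat 1 + U ** sign_mat J) \<noteq> 0 \<longrightarrow> to_nat (sign_pattern U) \<le>
      to_nat (sign_pattern (U ** sign_mat J)))"

lemma exists_canonical:
  fixes U :: "complex^'n^'n"
  obtains J where "det (mat 1 + U ** sign_mat J) \<noteq> 0" "canonical (U ** sign_mat J)"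
proof -
  obtain J0 where J0: "det (mat 1 + U ** sign_mat J0) \<noteq> 0" using exists_signs_det_nonzero by blast
  obtain J where J: "det (mat 1 + U ** sign_mat J) \<noteq> 0"
    and min: "\<And>K. det (mat 1 + U ** sign_mat K) \<noteq> 0 \<Longrightarrow> to_nat (sign_pattern (U ** sign_mat J)) \<le>
        to_nat (sign_pattern (U ** sign_mat K))"
    using ex_has_least_nat[of "\<lambda>J. det (mat 1 + U **
        sign_mat J) \<noteq> 0" J0 "\<lambda>J. to_nat (sign_pattern (U ** sign_mat J))", OF J0]
    by (elim exE conjE) simp
  \<comment> \<open>Sign matrices form a group, so the representatives reached from the minimizer
    are those reached from \<open>U\<close>.\<close>
  have "canonical (U ** sign_mat J)"
    unfolding canonical_def matrix_mul_assoc[symmetric] sign_mat_mult using min by blast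
  then show ?thesis using that J by blast
qed

text \<open>Both representatives minimize the code over the same orbit. Equal codes mean equal sign
  patterns, so no column has been flipped.\<close>

lemma canonical_unique:
  assumes "unitary U" "canonical U" "canonical (U ** sign_mat J)"
    "det (mat 1 + U) \<noteq> 0" "det (mat 1 + U ** sign_mat J) \<noteq> 0"
  shows "J = {}"
proof -
  have "to_nat (sign_pattern U) \<le> to_nat (sign_pattern (U ** sign_mat J))" using assms
      by (simp add: canonical_def)
  moreover have "to_nat (sign_pattern (U ** sign_mat J)) \<le> to_nat (sign_pattern U)"
    using assms(3)[unfolded canonical_def, rule_format, of J] assms(4) by simp
  ultimately have "to_nat (sign_pattern (U ** sign_mat J)) = to_nat (sign_pattern U)" by simp
  then have "sign_pattern (U ** sign_mat J) = sign_pattern U" by simp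
  then show ?thesis using sign_pattern_sign_mat[OF assms(1), of _ J] by auto
qed

definition fundamental :: "complex^'n^'n \<Rightarrow> bool" where
  "fundamental Z \<longleftrightarrow> positive_increasing (diag_of Z) \<and> canonical (cayley (skew_of Z))"

text \<open>These parameters are needed for surjectivity, although neither map need be injective on
  them; the Jacobians vanish here.\<close>

definition critical :: "complex^'n^'n \<Rightarrow> bool" where
  "critical Z \<longleftrightarrow> (\<exists>i j. diag_of Z i = 0 \<or> (i \<noteq> j \<and> diag_of Z i = diag_of Z j))"

section \<open>Injectivity and surjectivity of the two parametrizations\<close>

lemma nonneg_sorted_cases:
  assumes "nonneg_sorted s"
  shows "positive_increasing s \<or> (\<exists>i j. s i = 0 \<or> (i \<noteq> j \<and> s i = s j))"
proof (rule disjCI)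
  assume *: "\<not> (\<exists>i j. s i = 0 \<or> (i \<noteq> j \<and> s i = s j))"
  have "0 < s i" for i using assms * unfolding nonneg_sorted_def by (metis order_le_less)
  moreover have "s i < s j" if "rk i < rk j" for i j
  proof -
    have "s i \<le> s j" "i \<noteq> j" using assms that by (auto simp: nonneg_sorted_def)
    then show ?thesis using * by (metis order_le_less)
  qed
  ultimately show "positive_increasing s" by (simp add: positive_increasing_def)
qed

text \<open>\<open>V = adj U' ** U\<close> intertwines \<open>T\<close> and \<open>T'\<close>, hence
  is a sign matrix, and canonicity makes it trivial. Leaving \<open>T\<close> and \<open>T'\<close>
  general serves both maps: \<open>upper_of Z\<close> for one, a diagonal matrix for the
  other.\<close>

lemma fundamental_unique:
  fixes Z Z' T T' :: "complex^'n^'n"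
  defines "U \<equiv> cayley (skew_of Z)" and "U' \<equiv> cayley (skew_of Z')"
  assumes "fundamental Z" "fundamental Z'"
    and T: "upper T" "\<And>i. T $ i $ i = complex_of_real (diag_of Z i)"
    and T': "upper T'" "\<And>i. T' $ i $ i = complex_of_real (diag_of Z' i)"
    and eq: "U ** T ** transpose U = U' ** T' ** transpose U'"
  shows "skew_of Z = skew_of Z' \<and> T = T'"
proof -
  have U: "unitary U" "det (mat 1 + U) \<noteq> 0" "canonical U"
    and U': "unitary U'" "det (mat 1 + U') \<noteq> 0" "canonical U'"
    using assms(3,4) by (simp_all add: U_def U'_def cayley_unitary antiherm_skew_of cayley_det
        fundamental_def)
  have s: "positive_increasing (diag_of Z)" "positive_increasing (diag_of Z')" using assms(3,4)
      by (simp_all add: fundamental_def)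
  define V where "V = adj U' ** U"
  have "adj U' ** (U ** T ** transpose U) ** conj_mat U = V ** T ** (transpose U ** conj_mat U)"
    by (simp add: V_def matrix_mul_assoc)
  then have 1: "adj U' ** (U ** T ** transpose U) ** conj_mat U = V ** T" using U
      by (simp add: unitaryD)
  have "adj U' ** (U' ** T' ** transpose U') ** conj_mat U =
      (adj U' ** U') ** T' ** (transpose U' ** conj_mat U)"
    by (simp add: matrix_mul_assoc)
  then have "adj U' ** (U' ** T' ** transpose U') ** conj_mat U = T' ** conj_mat V"
    using U' by (simp add: unitaryD V_def conj_mat_mult adj_conj_mat)
  with 1 have "V ** T = T' ** conj_mat V" unfolding eq by simp
  moreover have "unitary V" unfolding V_def using U U' by (intro unitary_mult unitary_adj)
  ultimately obtain J where J: "V = sign_mat J" using schur_unique[OF _ T s(1) T' s(2)] by metis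
  have "U = U' ** V" unfolding V_def using U' by (simp add: matrix_mul_assoc unitaryD)
  then have UJ: "U = U' ** sign_mat J" using J by simp
  then have "J = {}" using canonical_unique[OF U'(1,3)] U U' by simp
  then have "sign_mat J = mat 1" by (auto simp: vec_eq_iff sign_mat_def mat_def)
  then have UU: "U = U'" using UJ by simp
  then have A: "skew_of Z = skew_of Z'"
    unfolding U_def U'_def using cayley_inj antiherm_skew_of by blast
  have "adj U ** (U ** T ** transpose U) ** conj_mat U =
      adj U ** (U ** T' ** transpose U) ** conj_mat U"
    using eq UU by simp
  moreover have "adj U ** (U ** T ** transpose U) ** conj_mat U = T" for T
  proof -
    have "adj U ** (U ** T ** transpose U) ** conj_mat U =
        (adj U ** U) ** T ** (transpose U ** conj_mat U)"
      by (simp add: matrix_mul_assoc)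
    then show ?thesis using U by (simp add: unitaryD)
  qed
  ultimately show ?thesis using A by simp
qed

lemma schur_map_inj: "inj_on schur_map {Z. fundamental Z}"
proof (rule inj_onI)
  fix Z Z' :: "complex^'n^'n" assume *: "Z \<in> {Z. fundamental Z}" "Z' \<in> {Z. fundamental Z}"
      "schur_map Z = schur_map Z'"
  have "skew_of Z = skew_of Z' \<and> upper_of Z = upper_of Z'"
    using * by (intro fundamental_unique upper_upper_of upper_of_diag) (auto simp: schur_map_def)
  then show "Z = Z'" using encode_inj by blast
qed

lemma upper_diag_mat: "upper (diag_mat s)" by (auto simp: upper_def diag_mat_def)

lemma diag_mat_diag: "diag_mat s $ i $ i = complex_of_real (s i)" by (simp add: diag_mat_def)

lemma takagi_map_inj: "inj_on takagi_map {Z. fundamental Z}"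
proof (rule inj_onI)
  fix Z Z' :: "complex^'n^'n" assume *: "Z \<in> {Z. fundamental Z}" "Z' \<in> {Z. fundamental Z}"
      "takagi_map Z = takagi_map Z'"
  have "symmetric_of (takagi_map Z) = symmetric_of (takagi_map Z')" using * by simp
  then have "skew_of Z = skew_of Z' \<and> diag_mat (diag_of Z) = diag_mat (diag_of Z')"
    unfolding takagi_map_def symmetric_of_encode_pair[OF congruence_sym[OF diag_mat_sym]]
    using * by (intro fundamental_unique upper_diag_mat diag_mat_diag) auto
  then have A: "skew_of Z = skew_of Z'" and d: "diag_mat (diag_of Z) = diag_mat (diag_of Z')" by auto
  have "upper_of Z $ i $ j = upper_of Z' $ i $ j" for i j
  proof (cases "rk i < rk j")
    case True
    have "takagi_map Z $ i $ j = takagi_map Z' $ i $ j" using * by simp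
    then show ?thesis using True by (simp add: takagi_map_def encode_pair_def upper_of_def)
  next
    case False
    have "diag_mat (diag_of Z) $ i $ j = diag_mat (diag_of Z') $ i $ j" using d by simp
    then show ?thesis using False by (auto simp: upper_of_def diag_mat_def diag_of_def)
  qed
  then have "upper_of Z = upper_of Z'" by (simp add: vec_eq_iff)
  then show "Z = Z'" using A encode_inj by blast
qed

text \<open>Flipping columns of \<open>U\<close> to reach the Cayley chart is compensated by
  conjugating \<open>T\<close> with the same signs, which preserves its shape and its
  diagonal.\<close>

lemma exists_parameter:
  fixes U T :: "complex^'n^'n"
  assumes "unitary U" "upper T" "\<And>i. T $ i $ i = complex_of_real (s i)" "nonneg_sorted s"
  obtains Z J where "cayley (skew_of Z) = U ** sign_mat J" "upper_of Z =
      sign_mat J ** T ** sign_mat J" "diag_of Z = s" "fundamental Z \<or> critical Z"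
proof -
  obtain J where J: "det (mat 1 + U ** sign_mat J) \<noteq> 0" "canonical (U ** sign_mat J)"
    by (rule exists_canonical)
  have "unitary (U ** sign_mat J)" using assms by (intro unitary_mult unitary_sign_mat)
  then obtain A where A: "antiherm A" "cayley A = U ** sign_mat J" using cayley_surj J by blast
  have T: "upper (sign_mat J ** T ** sign_mat J)" "\<And>i. (sign_mat J ** T ** sign_mat J) $ i $ i =
      complex_of_real (s i)"
    using assms(2,3) by (auto simp: upper_def sign_mat_left sign_mat_right)
  obtain Z where Z: "skew_of Z = A" "upper_of Z = sign_mat J ** T ** sign_mat J" "diag_of Z = s"
    using encode_surj[OF A(1) T] by blast
  have "fundamental Z \<or> critical Z"
    using nonneg_sorted_cases[OF assms(4)] J(2) by (auto simp: fundamental_def critical_def Z A)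
  then show ?thesis using that[of Z J] Z A by simp
qed

lemma condiagonalizable_schur_map:
  fixes M :: "complex^'n^'n"
  assumes "condiagonalizable M"
  obtains Z where "schur_map Z = M" "fundamental Z \<or> critical Z"
proof -
  obtain X D :: "complex^'n^'n" where "invertible X" "diagonal_matrix D" "M ** conj_mat X = X ** D"
    using assms unfolding condiagonalizable_iff by blast
  then obtain U T s where U: "unitary U" "upper T" "nonneg_sorted s" "\<And>i. T $ i $ i =
      complex_of_real (s i)"
    and M: "M = U ** T ** transpose U" using con_schur by metis
  obtain Z J where Z: "cayley (skew_of Z) = U ** sign_mat J" "upper_of Z =
      sign_mat J ** T ** sign_mat J" "fundamental Z \<or> critical Z"
    using exists_parameter[OF U(1,2,4,3)] by metis
  have "schur_map Z = U ** (sign_mat J ** sign_mat J) ** T ** (sign_mat J ** sign_mat J) ** transpose U"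
    unfolding schur_map_def Z transpose_mult by (simp only: matrix_mul_assoc sign_mat_sym)
  then have "schur_map Z = M" by (simp add: M)
  then show ?thesis using that Z by blast
qed

lemma schur_map_condiagonalizable:
  fixes Z :: "complex^'n^'n"
  assumes "fundamental Z"
  shows "condiagonalizable (schur_map Z)"
proof -
  let ?U = "cayley (skew_of Z)"
  have U: "unitary ?U" by (simp add: cayley_unitary antiherm_skew_of)
  obtain Y where Y: "invertible Y" "upper_of Z ** conj_mat Y = Y ** diag_mat (diag_of Z)"
    using upper_condiagonalize[OF upper_upper_of upper_of_diag] assms fundamental_def by metis
  have "schur_map Z ** conj_mat (?U ** Y) =
      ?U ** upper_of Z ** (transpose ?U ** conj_mat ?U) ** conj_mat Y"
    unfolding schur_map_def conj_mat_mult by (simp only: matrix_mul_assoc)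
  also have "\<dots> = ?U ** (upper_of Z ** conj_mat Y)" using U by (simp add: unitaryD matrix_mul_assoc)
  also have "\<dots> = (?U ** Y) ** diag_mat (diag_of Z)" unfolding Y by (simp add: matrix_mul_assoc)
  finally have "schur_map Z ** conj_mat (?U ** Y) = (?U ** Y) ** diag_mat (diag_of Z)" .
  moreover have "invertible (?U ** Y)" using U Y invertible_mult unitary_invertible by blast
  moreover have "diagonal_matrix (diag_mat (diag_of Z))" by (simp add: diagonal_matrix_def diag_mat_def)
  ultimately show ?thesis unfolding condiagonalizable_iff by blast
qed

text \<open>Conjugation by signs fixes \<open>diag_mat s\<close>, so the signs of \<open>U\<close>
  can be adjusted while the strict upper triangle of \<open>N\<close> is copied unchanged.\<close>

lemma takagi_map_surj:
  fixes N :: "complex^'n^'n"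
  obtains Z where "takagi_map Z = N" "fundamental Z \<or> critical Z"
proof -
  obtain U s where U: "unitary U" "nonneg_sorted s" and S: "symmetric_of N =
      U ** diag_mat s ** transpose U"
    using takagi[OF symmetric_of_sym] by metis
  define T where "T = (\<chi> i j. if rk i < rk j then N $ i $ j else
      if i = j then complex_of_real (s i) else 0)"
  obtain J where J: "det (mat 1 + U ** sign_mat J) \<noteq> 0" "canonical (U ** sign_mat J)"
    by (rule exists_canonical)
  have "unitary (U ** sign_mat J)" using U by (intro unitary_mult unitary_sign_mat)
  then obtain A where A: "antiherm A" "cayley A = U ** sign_mat J" using cayley_surj J by blast
  have T: "upper T" "\<And>i. T $ i $ i = complex_of_real (s i)"
    by (auto simp: upper_def T_def)
  obtain Z where Z: "skew_of Z = A" "upper_of Z = T" "diag_of Z = s"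
    using encode_surj[OF A(1) T] by blast
  have dz: "fundamental Z \<or> critical Z"
    using nonneg_sorted_cases[OF U(2)] J(2) by (auto simp: fundamental_def critical_def Z A)
  have up: "Z $ i $ j = N $ i $ j" if "rk i < rk j" for i j
  proof -
    have "upper_of Z $ i $ j = T $ i $ j" using Z by simp
    then show ?thesis using that by (simp add: upper_of_def T_def)
  qed
  have c: "sign_mat J ** diag_mat s ** sign_mat J = diag_mat s"
    unfolding vec_eq_iff by (auto simp: sign_mat_left sign_mat_right diag_mat_def)
  have "U ** sign_mat J ** diag_mat s ** transpose (U ** sign_mat J) =
      U ** (sign_mat J ** diag_mat s ** sign_mat J) ** transpose U"
    unfolding transpose_mult by (simp only: matrix_mul_assoc sign_mat_sym)
  also have "\<dots> = symmetric_of N" unfolding c S ..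
  finally have "takagi_map Z = encode_pair (symmetric_of N) Z" by (simp add: takagi_map_def Z A)
  also have "\<dots> = encode_pair (symmetric_of N) N" using up by (rule encode_pair_cong)
  also have "\<dots> = N" by (rule encode_pair_symmetric_of)
  finally show ?thesis using that dz by blast
qed

lemma real_det_critical:
  assumes "critical Z"
  shows "real_det (schur_map_deriv Z) = 0" "real_det (takagi_map_deriv Z) = 0"
proof -
  obtain i j where "diag_of Z i = 0 \<or> (i \<noteq> j \<and> diag_of Z i = diag_of Z j)" using assms
      by (auto simp: critical_def)
  then have "real_det (takagi_differential (diag_of Z)) = 0"
      by (rule real_det_takagi_differential_critical)
  then have "\<bar>real_det (schur_map_deriv Z)\<bar> = 0" "\<bar>real_det (takagi_map_deriv Z)\<bar> = 0"
      by (simp_all add: real_det_schur_map_deriv real_det_takagi_map_deriv)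
  then show "real_det (schur_map_deriv Z) = 0" "real_det (takagi_map_deriv Z) = 0" by simp_all
qed

section \<open>Gaussian integrals\<close>

lemma continuous_cayley: "continuous_on S (\<lambda>Z. cayley (skew_of Z))"
  using cayley_has_derivative has_derivative_continuous continuous_at_imp_continuous_on by blast

lemma borel_measurable_component2:
  fixes f :: "'a::topological_space \<Rightarrow> complex^'n^'n"
  assumes "continuous_on UNIV f"
  shows "(\<lambda>x. f x $ i $ j) \<in> borel_measurable borel"
  using assms by (intro borel_measurable_continuous_onI continuous_on_component)

lemma fundamental_borel: "{x. fundamental (matrix_of_vec x)} \<in> sets (borel :: (real^('n::finite)
    coords) measure)"
proof -
  let ?U = "\<lambda>x :: real^'n coords. cayley (skew_of (matrix_of_vec x))"
  have cont: "continuous_on UNIV (\<lambda>x. ?U x ** sign_mat J)" for J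
    by (intro matrix_mult.continuous_on continuous_on_const continuous_on_compose2[OF
        continuous_cayley[of UNIV]]
        linear_cont[OF linear_matrix_of_vec]) auto
  have [measurable]: "(\<lambda>x. (?U x ** sign_mat J) $ i $ j) \<in> borel_measurable borel" for J i j
    by (rule borel_measurable_component2[OF cont])
  have U: "?U x = ?U x ** sign_mat {}" for x
    by (simp add: vec_eq_iff sign_mat_right)
  have [measurable]: "(\<lambda>x. diag_of (matrix_of_vec x) i)
      \<in> borel_measurable (borel :: (real^'n coords) measure)" for i
    unfolding diag_of_def matrix_of_vec_def
        by (intro borel_measurable_continuous_onI) (simp add: continuous_on_component continuous_on_id)
  have [measurable]: "Measurable.pred borel (\<lambda>x. j \<in> sign_pattern (?U x ** sign_mat J))" for j J
    unfolding sign_pattern_def mem_Collect_eq positive_vec_def column_def vec_lambda_beta by measurable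
  have [measurable]: "(\<lambda>x. det (mat 1 + ?U x ** sign_mat J)) \<in> borel_measurable borel" for J
    unfolding det_def vector_add_component by measurable
  \<comment> \<open>Naming the set-valued patterns by \<open>P\<close> and \<open>Q\<close> from a
    finite type reduces measurability to single memberships. The factor \<open>sign_mat {}\<close>
    is the identity and lets one measurability fact cover both patterns.\<close>
  have "fundamental (matrix_of_vec x) \<longleftrightarrow> positive_increasing (diag_of (matrix_of_vec x)) \<and>
     (\<forall>J. det (mat 1 + ?U x ** sign_mat J) \<noteq> 0 \<longrightarrow>
       (\<exists>P Q. to_nat P \<le> to_nat Q \<and> (\<forall>j. j \<in> sign_pattern (?U x ** sign_mat {}) \<longleftrightarrow> j \<in> P) \<and>
           (\<forall>j. j \<in> sign_pattern (?U x ** sign_mat J) \<longleftrightarrow> j \<in> Q)))" for x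
    unfolding fundamental_def canonical_def U[symmetric] set_eq_iff[symmetric] by simp
  moreover have "Measurable.pred borel (\<lambda>x. positive_increasing (diag_of (matrix_of_vec x)) \<and>
     (\<forall>J. det (mat 1 + ?U x ** sign_mat J) \<noteq> 0 \<longrightarrow>
       (\<exists>P Q. to_nat P \<le> to_nat Q \<and> (\<forall>j. j \<in> sign_pattern (?U x ** sign_mat {}) \<longleftrightarrow> j \<in> P) \<and>
           (\<forall>j. j \<in> sign_pattern (?U x ** sign_mat J) \<longleftrightarrow> j \<in> Q))))"
    unfolding positive_increasing_def by measurable
  ultimately have "Measurable.pred (borel :: (real^'n coords) measure) (\<lambda>x. fundamental
      (matrix_of_vec x))" by simp
  then show ?thesis by (simp add: pred_def)
qed

text \<open>The set is a countable union of continuous images of compact sets.\<close>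

lemma condiagonalizable_borel: "{M :: complex^'n^'n. condiagonalizable M} \<in> sets borel"
proof -
  \<comment> \<open>Carrying the inverse \<open>Y\<close> as a separate variable turns
    invertibility, an open condition, into the closed equation
    \<open>X ** Y = mat 1\<close>.\<close>
  define K where "K n = {(X, Y, D). X ** Y = mat 1 \<and>
      diagonal_matrix D} \<inter> cball (0 :: (complex^'n^'n) \<times> (complex^'n^'n) \<times> (complex^'n^'n)) (real
      n)" for n
  define F where "F = (\<lambda>(X :: complex^'n^'n, Y :: complex^'n^'n, D :: complex^'n^'n). X ** D **
      conj_mat Y)"
  have cF: "continuous_on S F" for S
    unfolding F_def split_def
    by (intro matrix_mult.continuous_on continuous_intros continuous_on_compose2[OF linear_cont[OF
        linear_conj_mat, of UNIV]]) auto
  have "closed {(X :: complex^'n^'n, Y :: complex^'n^'n, D :: complex^'n^'n). X ** Y = mat 1 \<and>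
      diagonal_matrix D}"
  proof -
    have eq: "{(X :: complex^'n^'n, Y :: complex^'n^'n, D :: complex^'n^'n). X ** Y = mat 1 \<and>
        diagonal_matrix D}
      = {z. fst z ** fst (snd z) = mat 1} \<inter> (\<Inter>i. \<Inter>j. {z. i \<noteq> j \<longrightarrow> snd (snd z) $ i $ j = 0})"
      by (auto simp: diagonal_matrix_def)
    have "closed {z :: (complex^'n^'n) \<times> (complex^'n^'n) \<times> (complex^'n^'n). fst z ** fst (snd z) =
        mat 1}"
      by (intro closed_Collect_eq matrix_mult.continuous_on continuous_intros)
    moreover have "closed {z :: (complex^'n^'n) \<times> (complex^'n^'n) \<times> (complex^'n^'n). i \<noteq> j \<longrightarrow>
        snd (snd z) $ i $ j = 0}" for i j
      by (intro closed_Collect_imp open_Collect_const closed_Collect_eq continuous_intros)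
    ultimately show ?thesis unfolding eq by (intro closed_Int closed_INT) auto
  qed
  then have "compact (K n)" for n
    unfolding K_def by (intro closed_Int_compact compact_cball)
  then have c: "F ` K n \<in> sets borel" for n
    using cF compact_continuous_image compact_imp_closed borel_closed by metis
  have "{M :: complex^'n^'n. condiagonalizable M} = (\<Union>n. F ` K n)"
  proof safe
    fix M :: "complex^'n^'n" assume "condiagonalizable M"
    then obtain X D :: "complex^'n^'n" where X: "invertible X" "diagonal_matrix D"
      "M = X ** D ** conj_mat (matrix_inv X)" unfolding condiagonalizable_def conj_mat_def by blast
    obtain n where "norm (X, matrix_inv X, D) \<le> real n" using real_arch_simple by blast
    then have "(X, matrix_inv X, D) \<in> K n" using X by (simp add: K_def matrix_inv_mult)
    moreover have "M = F (X, matrix_inv X, D)" using X by (simp add: F_def)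
    ultimately show "M \<in> (\<Union>n. F ` K n)" by blast
  next
    fix n X Y and D :: "complex^'n^'n" assume "(X, Y, D) \<in> K n"
    then have *: "X ** Y = mat 1" "diagonal_matrix D" by (auto simp: K_def)
    then have "invertible X" "matrix_inv X = Y"
      using matrix_inv_unique matrix_left_right_inverse invertible_def by blast+
    then show "condiagonalizable (F (X, Y, D))"
      unfolding condiagonalizable_def F_def conj_mat_def using * by auto
  qed
  then show ?thesis using c by auto
qed

section \<open>The standard Gaussian density and the law of the random matrix\<close>

definition gauss :: "real^'k \<Rightarrow> real" where
  "gauss x = (\<Prod>k\<in>UNIV. std_normal_density (x $ k))"

text \<open>The product of the densities depends only on the sum of the squares. This lets equality
  of norms under the two maps replace any finer comparison.\<close>

lemma gauss_norm:
  fixes x y :: "real^'k"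
  assumes "norm x = norm y"
  shows "gauss x = gauss y"
proof -
  have *: "gauss z = (1 / sqrt (2 * pi)) ^ CARD('k) * exp (- (norm z)\<^sup>2 / 2)" for z :: "real^'k"
  proof -
    have "gauss z = (\<Prod>k\<in>(UNIV :: 'k set). 1 / sqrt (2 * pi)) * (\<Prod>k\<in>UNIV. exp (- (z $ k)\<^sup>2 / 2))"
      unfolding gauss_def std_normal_density_def prod.distrib ..
    also have "(\<Prod>k\<in>UNIV. exp (- (z $ k)\<^sup>2 / 2)) = exp (\<Sum>k\<in>UNIV. - (z $ k)\<^sup>2 / 2)"
      by (simp add: exp_sum)
    also have "(\<Sum>k\<in>UNIV. - (z $ k)\<^sup>2 / 2) = - (norm z)\<^sup>2 / 2"
      unfolding norm_vec_def L2_set_def by (simp add: sum_nonneg sum_negf sum_divide_distrib)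
    finally show ?thesis by simp
  qed
  show ?thesis unfolding * assms ..
qed

lemma gauss_nonneg: "0 \<le> gauss x"
  unfolding gauss_def by (intro prod_nonneg) auto

lemma gauss_measurable [measurable]: "gauss \<in> borel_measurable borel"
  unfolding gauss_def by measurable

lemma Basis_real_vec: "(Basis :: (real^'k) set) = range (\<lambda>k. axis k 1)"
  by (auto simp: Basis_vec_def)

lemma prod_Basis_vec: "(\<Prod>b\<in>(Basis :: (real^'k) set). h b) = (\<Prod>k\<in>UNIV. h (axis k 1))"
  for h :: "real^'k \<Rightarrow> 'b::comm_monoid_mult"
proof -
  have "inj (\<lambda>k :: 'k. axis k (1 :: real))" by (auto simp: inj_def axis_eq_axis)
  then show ?thesis unfolding Basis_real_vec by (simp add: prod.reindex)
qed

lemma nn_integral_gauss_box: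
  "(\<integral>\<^sup>+x. ennreal (gauss x) * indicator (box a b) x \<partial>lborel) =
   (\<Prod>k\<in>UNIV. \<integral>\<^sup>+t. ennreal (std_normal_density t) * indicator {a $ k <..< b $ k} t \<partial>lborel)"
  for a b :: "real^'k"
proof -
  define f where "f c t = ennreal (std_normal_density t) * indicator {a \<bullet> c <..< b \<bullet> c} t"
      for c :: "real^'k" and t
  have "ennreal (gauss x) * indicator (box a b) x = (\<Prod>c\<in>Basis. f c (x \<bullet> c))" for x
  proof -
    have "(\<Prod>k\<in>UNIV. indicator {a $ k <..< b $ k} (x $ k) :: ennreal) = indicator (box a b) x"
      by (auto simp: indicator_def mem_box_cart prod_eq_1_iff intro!: prod_zero prod.neutral)
    then show ?thesis
      unfolding prod_Basis_vec f_def gauss_def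
      by (simp add: prod.distrib prod_ennreal cart_eq_inner_axis[symmetric] inner_axis)
  qed
  then have "(\<integral>\<^sup>+x. ennreal (gauss x) * indicator (box a b) x \<partial>lborel) =
      (\<integral>\<^sup>+x. (\<Prod>c\<in>Basis. f c (x \<bullet> c)) \<partial>lborel)"
    by simp
  also have "\<dots> = (\<Prod>c\<in>Basis. \<integral>\<^sup>+t. f c t \<partial>lborel)"
    by (rule nn_integral_lborel_prod) (auto simp: f_def)
  also have "\<dots> = (\<Prod>k\<in>UNIV. \<integral>\<^sup>+t. ennreal (std_normal_density t) * indicator {a $ k <..< b $ k} t
      \<partial>lborel)"
    unfolding prod_Basis_vec f_def by (simp add: inner_axis)
  finally show ?thesis .
qed

text \<open>Open boxes are an intersection-stable generator of the Borel sets. On them independence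
  factors the left side, and Fubini the right.\<close>

lemma gaussian_law:
  fixes P :: "'a measure" and M :: "'a \<Rightarrow> complex^'n^'n"
  assumes "prob_space P"
    and ind: "prob_space.indep_vars P (\<lambda>_. borel)
           (\<lambda>(i, j, re) \<omega>. if re then Re (M \<omega> $ i $ j) else Im (M \<omega> $ i $ j))
           (UNIV :: ('n \<times> 'n \<times> bool) set)"
    and Re: "\<And>i j. distributed P lborel (\<lambda>\<omega>. Re (M \<omega> $ i $ j)) std_normal_density"
    and Im: "\<And>i j. distributed P lborel (\<lambda>\<omega>. Im (M \<omega> $ i $ j)) std_normal_density"
  shows "(\<lambda>\<omega>. vec_of_matrix (M \<omega>)) \<in> measurable P borel"
    and "distr P borel (\<lambda>\<omega>. vec_of_matrix (M \<omega>)) = density lborel (\<lambda>x. ennreal (gauss x))"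
proof -
  interpret prob_space P by (rule assms(1))
  define X where "X = (\<lambda>(i, j, re) \<omega>. if re then Re (M \<omega> $ i $ j) else Im (M \<omega> $ i $ j))"
  have X: "distributed P lborel (X k) std_normal_density" for k
  proof -
    obtain i j b where "k = (i, j, b)" by (rule prod_cases3)
    then show ?thesis using Re[of i j] Im[of i j] by (cases b) (simp_all add: X_def)
  qed
  have vX: "vec_of_matrix (M \<omega>) $ k = X (unranked k) \<omega>" for \<omega> k
    by (cases k) (auto simp: vec_of_matrix_def X_def split: prod.splits)
  have mX [measurable]: "X k \<in> borel_measurable P" for k
    using distributed_measurable[OF X[of k]] by simp
  show m: "(\<lambda>\<omega>. vec_of_matrix (M \<omega>)) \<in> measurable P borel"
  proof (rule borel_measurable_euclidean_space[THEN iffD2], rule ballI)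
    fix b :: "real^'n coords" assume "b \<in> Basis"
    then obtain k where "b = axis k 1" unfolding Basis_real_vec by (rule rangeE)
    then have "(\<lambda>\<omega>. vec_of_matrix (M \<omega>) \<bullet> b) = X (unranked k)" by (simp add: fun_eq_iff inner_axis vX)
    then show "(\<lambda>\<omega>. vec_of_matrix (M \<omega>) \<bullet> b) \<in> borel_measurable P" using mX by simp
  qed
  show "distr P borel (\<lambda>\<omega>. vec_of_matrix (M \<omega>)) = density lborel (\<lambda>x. ennreal (gauss x))"
  proof (rule measure_eqI_generator_eq)
    let ?E = "range (\<lambda>(a, b). box a b :: (real^'n coords) set)"
    show "Int_stable ?E" by (auto simp: Int_stable_def box_Int_box)
    show "?E \<subseteq> Pow UNIV" "sets (distr P borel (\<lambda>\<omega>. vec_of_matrix (M \<omega>))) = sigma_sets UNIV ?E"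
      "sets (density lborel (\<lambda>x. ennreal (gauss x))) = sigma_sets UNIV ?E"
      by (simp_all add: borel_eq_box)
    let ?A = "\<lambda>n::nat. box (- (real n *\<^sub>R One)) (real n *\<^sub>R One) :: (real^'n coords) set"
    show "range ?A \<subseteq> ?E" "(\<Union>i. ?A i) = UNIV"
      unfolding UN_box_eq_UNIV by auto
    show "emeasure (distr P borel (\<lambda>\<omega>. vec_of_matrix (M \<omega>))) (?A i) \<noteq> \<infinity>" for i
      using m by (simp add: emeasure_distr)
    fix B :: "(real^'n coords) set" assume "B \<in> ?E"
    then obtain a b where B: "B = box a b" by auto
    let ?I = "\<lambda>k. {a $ Ranked k <..< b $ Ranked k}"
    have "(\<lambda>\<omega>. vec_of_matrix (M \<omega>)) -` B \<inter> space P = (\<Inter>k\<in>UNIV. X k -` ?I k \<inter> space P)"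
    proof -
      have "vec_of_matrix (M \<omega>) \<in> B \<longleftrightarrow> (\<forall>k. X k \<omega> \<in> ?I k)" for \<omega>
        unfolding B mem_box_cart vX by (metis greaterThanLessThan_iff ranked.collapse ranked.sel)
      then show ?thesis by auto
    qed
    then have "emeasure (distr P borel (\<lambda>\<omega>. vec_of_matrix (M \<omega>))) B =
        ennreal (prob (\<Inter>k\<in>UNIV. X k -` ?I k \<inter> space P))"
      using m by (simp add: emeasure_distr B emeasure_eq_measure)
    also have "prob (\<Inter>k\<in>UNIV. X k -` ?I k \<inter> space P) = (\<Prod>k\<in>UNIV. prob (X k -` ?I k \<inter> space P))"
      using ind unfolding X_def[symmetric] by (rule indep_varsD_finite) auto
    also have "ennreal \<dots> = (\<Prod>k\<in>UNIV. emeasure P (X k -` ?I k \<inter> space P))"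
      by (simp add: prod_ennreal emeasure_eq_measure)
    also have "\<dots> = (\<Prod>k\<in>UNIV. \<integral>\<^sup>+t. ennreal (std_normal_density t) * indicator (?I k) t \<partial>lborel)"
      by (intro prod.cong refl distributed_emeasure[OF X]) auto
    also have "\<dots> = (\<Prod>k\<in>UNIV. \<integral>\<^sup>+t. ennreal (std_normal_density t) * indicator {a $ k <..< b $ k} t
        \<partial>lborel)"
      unfolding ranked_UNIV by (subst prod.reindex) (auto simp: inj_on_def)
    also have "\<dots> = emeasure (density lborel (\<lambda>x. ennreal (gauss x))) B"
      unfolding nn_integral_gauss_box[symmetric] B by (subst emeasure_density) auto
    finally show "emeasure (distr P borel (\<lambda>\<omega>. vec_of_matrix (M \<omega>))) B =
        emeasure (density lborel (\<lambda>x. ennreal (gauss x))) B" .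
  qed
qed

text \<open>That \<open>gauss\<close> has total mass one enters as an assumption: it will follow
  from its being the law of the random matrix, without evaluating an integral.\<close>

lemma measure_gauss:
  fixes C :: "(real^'k) set"
  assumes "prob_space (density lborel (\<lambda>x :: real^'k. ennreal (gauss x)))" and C: "C \<in> sets borel"
  shows "gauss absolutely_integrable_on C"
    and "measure (density lborel (\<lambda>x. ennreal (gauss x))) C = integral C gauss"
proof -
  have "(\<integral>\<^sup>+x. ennreal (gauss (x :: real^'k)) \<partial>lborel) = 1"
    using prob_space.emeasure_space_1[OF assms(1)] by (simp add: emeasure_density)
  then have "integrable lborel (gauss :: real^'k \<Rightarrow> real)"
    by (intro integrableI_nonneg) (auto simp: gauss_nonneg)
  then have int: "set_integrable lborel C gauss"
    unfolding set_integrable_def using C by (intro integrable_mult_indicator) auto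
  then have "integrable lebesgue (\<lambda>x. indicator C x *\<^sub>R gauss x)"
    unfolding set_integrable_def by (subst integrable_completion) (auto simp: integrable_iff_bounded)
  then show "gauss absolutely_integrable_on C" by (simp add: set_integrable_def)
  have "measure (density lborel (\<lambda>x. ennreal (gauss x))) C =
      enn2real (\<integral>\<^sup>+x. ennreal (indicator C x *\<^sub>R gauss x) \<partial>lborel)"
    unfolding measure_def using C
    by (subst emeasure_density) (auto intro!: arg_cong[where f =
        enn2real] nn_integral_cong simp: indicator_def)
  also have "\<dots> = (LINT x:C|lborel. gauss x)"
    unfolding set_lebesgue_integral_def using int[unfolded set_integrable_def] gauss_nonneg
    by (subst integral_eq_nn_integral) (auto intro!: AE_I2 mult_nonneg_nonneg)
  also have "\<dots> = integral C gauss" by (rule set_borel_integral_eq_integral(2)[OF int])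
  finally show "measure (density lborel (\<lambda>x. ennreal (gauss x))) C = integral C gauss" .
qed

section \<open>Change of variables and comparison of the integrals\<close>

lemma vectorized_has_derivative:
  fixes f :: "complex^'n^'n \<Rightarrow> complex^'n^'n"
  assumes "\<And>Z. (f has_derivative f' Z) (at Z)"
  shows "((vec_of_matrix \<circ> f \<circ> matrix_of_vec) has_derivative (vec_of_matrix \<circ>
      f' (matrix_of_vec x) \<circ> matrix_of_vec)) (at x within S)"
proof -
  have "(f \<circ> matrix_of_vec has_derivative f' (matrix_of_vec x) \<circ> matrix_of_vec) (at x within S)"
    by (rule diff_chain_within[OF linear_has_derivative[OF linear_matrix_of_vec]])
      (rule has_derivative_at_withinI[OF assms])
  then have "(vec_of_matrix \<circ> (f \<circ> matrix_of_vec) has_derivative vec_of_matrix \<circ>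
      (f' (matrix_of_vec x) \<circ> matrix_of_vec)) (at x within S)"
    by (rule diff_chain_within) (rule linear_has_derivative[OF linear_vec_of_matrix])
  then show ?thesis by (simp add: o_assoc)
qed

text \<open>Sard's theorem in equal dimensions, with rank deficiency read off from the vanishing
  determinant.\<close>

lemma negligible_critical_image:
  fixes f :: "complex^'n^'n \<Rightarrow> complex^'n^'n"
  assumes "\<And>Z. (f has_derivative f' Z) (at Z)" "\<And>Z. critical Z \<Longrightarrow> real_det (f' Z) = 0"
  shows "negligible ((vec_of_matrix \<circ> f \<circ> matrix_of_vec) ` {x. critical (matrix_of_vec x)})"
proof (rule baby_Sard)
  show "((vec_of_matrix \<circ> f \<circ> matrix_of_vec) has_derivative (vec_of_matrix \<circ>
      f' (matrix_of_vec x) \<circ> matrix_of_vec)) (at x within {x. critical (matrix_of_vec x)})" for x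
    using assms(1) by (rule vectorized_has_derivative)
  show "rank (matrix (vec_of_matrix \<circ> f' (matrix_of_vec x) \<circ> matrix_of_vec)) < CARD('n coords)"
      if "x \<in> {x. critical (matrix_of_vec x)}" for x
    using assms(2)[of "matrix_of_vec x"] that unfolding real_det_def det_eq_0_rank by simp
qed simp

text \<open>Stated as an equivalence because it is read in both directions: from image to domain for
  \<open>takagi_map\<close>, from domain to image for \<open>schur_map\<close>.\<close>

lemma change_of_variables_vec:
  fixes g :: "real^('n::finite) coords \<Rightarrow> real^1" and f :: "complex^'n^'n \<Rightarrow> complex^'n^'n"
  assumes "\<And>Z. (f has_derivative f' Z) (at Z)" "inj_on f {Z. fundamental Z}"
  defines "W \<equiv> {x. fundamental (matrix_of_vec x)}" and "F \<equiv> vec_of_matrix \<circ> f \<circ> matrix_of_vec"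
  shows "(\<lambda>x. \<bar>real_det (f' (matrix_of_vec x))\<bar> *\<^sub>R g (F x)) absolutely_integrable_on W \<and>
      integral W (\<lambda>x. \<bar>real_det (f' (matrix_of_vec x))\<bar> *\<^sub>R g (F x)) = b \<longleftrightarrow>
    g absolutely_integrable_on (F ` W) \<and> integral (F ` W) g = b"
  unfolding real_det_def
proof (rule has_absolute_integral_change_of_variables)
  show "W \<in> sets lebesgue" unfolding W_def using fundamental_borel by auto
  show "(F has_derivative (vec_of_matrix \<circ> f' (matrix_of_vec x) \<circ> matrix_of_vec)) (at x within W)" for x
    unfolding F_def using assms(1) by (rule vectorized_has_derivative)
  show "inj_on F W"
  proof (rule inj_onI)
    fix x y assume *: "x \<in> W" "y \<in> W" "F x = F y"
    then have "matrix_of_vec (F x) = matrix_of_vec (F y)" by simp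
    then have "f (matrix_of_vec x) = f (matrix_of_vec y)" by (simp add: F_def)
    then have "matrix_of_vec x = matrix_of_vec y" using assms(2) * by (simp add: inj_on_def W_def)
    then show "x = y" by (metis vec_of_matrix_matrix_of_vec)
  qed
qed

text \<open>The Takagi side carries the full mass 1, since the image of \<open>W\<close> misses only
  a null set. Dividing by the ratio \<open>c\<close> of the Jacobians gives the mass of the image
  under \<open>schur_map\<close>, which is \<open>C\<close> up to a null set.\<close>

lemma gauss_condiagonalizable:
  fixes C :: "(real^('n::finite) coords) set"
  defines "C \<equiv> {x. condiagonalizable (matrix_of_vec x)}"
  assumes prob: "prob_space (density lborel (\<lambda>x :: real^'n coords. ennreal (gauss x)))"
  shows "integral C gauss = 2 powr (- (real CARD('n) * (real CARD('n) - 1) / 2))"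
proof -
  define c where "c = 2 powr (real CARD('n) * (real CARD('n) - 1) / 2)"
  have c: "c > 0" by (simp add: c_def)
  define W where "W = {x :: real^'n coords. fundamental (matrix_of_vec x)}"
  define \<psi> where "\<psi> = (vec_of_matrix \<circ> schur_map \<circ> matrix_of_vec :: real^'n coords \<Rightarrow> _)"
  define \<Phi> where "\<Phi> = (vec_of_matrix \<circ> takagi_map \<circ> matrix_of_vec :: real^'n coords \<Rightarrow> _)"
  \<comment> \<open>The change of variables is stated for integrands with values in
    \<open>real^1\<close>; \<open>h\<close> embeds the reals there.\<close>
  define h where "h = (\<lambda>t. t *\<^sub>R (1 :: real^1))"
  define g where "g = h \<circ> (gauss :: real^'n coords \<Rightarrow> real)"
  have h: "bounded_linear h" unfolding h_def by (rule bounded_linear_scaleR_left)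
  have "integral UNIV (gauss :: real^'n coords \<Rightarrow> real) = 1"
    using measure_gauss(2)[OF prob, of UNIV] prob_space.prob_space[OF prob] by simp
  moreover have gi: "(gauss :: real^'n coords \<Rightarrow> real) absolutely_integrable_on UNIV"
    using measure_gauss(1)[OF prob, of UNIV] by simp
  ultimately have g: "g absolutely_integrable_on UNIV" "integral UNIV g = h 1"
    unfolding g_def using h by (auto intro: absolutely_integrable_linear
        simp: integral_linear set_lebesgue_integral_eq_integral)
  have negPhi: "negligible (UNIV - \<Phi> ` W)"
  proof (rule negligible_subset)
    show "negligible ((vec_of_matrix \<circ> takagi_map \<circ>
        matrix_of_vec) ` {x :: real^'n coords. critical (matrix_of_vec x)})"
      using takagi_map_has_derivative real_det_critical(2) by (rule negligible_critical_image)
    show "UNIV - \<Phi> ` W \<subseteq> (vec_of_matrix \<circ> takagi_map \<circ>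
        matrix_of_vec) ` {x :: real^'n coords. critical (matrix_of_vec x)}"
    proof
      fix y :: "real^'n coords" assume y: "y \<in> UNIV - \<Phi> ` W"
      obtain Z where Z: "takagi_map Z = matrix_of_vec y" "fundamental Z \<or> critical Z"
          by (rule takagi_map_surj)
      have "y = (vec_of_matrix \<circ> takagi_map \<circ> matrix_of_vec) (vec_of_matrix Z)" using Z by simp
      moreover have "critical Z"
        using y Z(2) calculation by (auto simp: W_def \<Phi>_def image_iff) (metis
            matrix_of_vec_vec_of_matrix)
      ultimately show "y \<in> (vec_of_matrix \<circ> takagi_map \<circ>
          matrix_of_vec) ` {x. critical (matrix_of_vec x)}"
        by (metis (mono_tags, lifting) image_eqI mem_Collect_eq matrix_of_vec_vec_of_matrix)
    qed
  qed
  have "g absolutely_integrable_on (\<Phi> ` W)"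
    using g(1) by (rule absolutely_integrable_spike_set) (auto intro: negligible_subset[OF negPhi])
  moreover have "integral (\<Phi> ` W) g = h 1"
    unfolding g(2)[symmetric] by (rule integral_spike_set) (auto intro: negligible_subset[OF negPhi])
  ultimately have "(\<lambda>x. \<bar>real_det (takagi_map_deriv (matrix_of_vec x))\<bar> *\<^sub>R g (\<Phi> x))
      absolutely_integrable_on W \<and>
      integral W (\<lambda>x. \<bar>real_det (takagi_map_deriv (matrix_of_vec x))\<bar> *\<^sub>R g (\<Phi> x)) = h 1"
    unfolding \<Phi>_def W_def
    using change_of_variables_vec[OF takagi_map_has_derivative takagi_map_inj, of g "h 1"] by blast
  \<comment> \<open>The integrands over \<open>W\<close> differ by the constant \<open>c\<close>
    alone: the determinants by that factor, and the Gaussian weights not at all.\<close>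
  moreover have "\<bar>real_det (takagi_map_deriv (matrix_of_vec x))\<bar> *\<^sub>R g (\<Phi> x) =
      c *\<^sub>R (\<bar>real_det (schur_map_deriv (matrix_of_vec x))\<bar> *\<^sub>R g (\<psi> x))" for x
  proof -
    have "gauss (\<Phi> x) = gauss (\<psi> x)"
      by (rule gauss_norm) (simp add: \<Phi>_def \<psi>_def norm_vec_of_matrix norm_schur_map_takagi_map)
    then show ?thesis by (simp add: real_det_takagi_map_deriv c_def g_def)
  qed
  ultimately have *: "(\<lambda>x. c *\<^sub>R (\<bar>real_det (schur_map_deriv (matrix_of_vec x))\<bar> *\<^sub>R g (\<psi> x)))
      absolutely_integrable_on W"
      "integral W (\<lambda>x. c *\<^sub>R (\<bar>real_det (schur_map_deriv (matrix_of_vec x))\<bar> *\<^sub>R g (\<psi> x))) = h 1"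
          by simp_all
  have "(\<lambda>x. \<bar>real_det (schur_map_deriv (matrix_of_vec x))\<bar> *\<^sub>R g (\<psi> x)) absolutely_integrable_on W"
    using set_integrable_scaleR_right[OF *(1), of "1 / c"] c by simp
  moreover have "integral W (\<lambda>x. \<bar>real_det (schur_map_deriv (matrix_of_vec x))\<bar> *\<^sub>R g (\<psi> x)) =
      (1 / c) *\<^sub>R h 1"
  proof -
    have "(1 / c) *\<^sub>R (c *\<^sub>R integral W (\<lambda>x. \<bar>real_det (schur_map_deriv (matrix_of_vec x))\<bar> *\<^sub>R g
        (\<psi> x))) = (1 / c) *\<^sub>R h 1"
      using *(2) unfolding integral_cmul by (rule arg_cong)
    then show ?thesis using c by simp
  qed
  ultimately have "g absolutely_integrable_on (\<psi> ` W) \<and> integral (\<psi> ` W) g = (1 / c) *\<^sub>R h 1"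
    unfolding \<psi>_def W_def
    using change_of_variables_vec[OF schur_map_has_derivative schur_map_inj,
        of g "(1 / c) *\<^sub>R h 1"] by blast
  \<comment> \<open>A condiagonalizable matrix outside the image of \<open>W\<close> comes from a
    critical parameter.\<close>
  moreover have negpsi: "negligible (C - \<psi> ` W)"
  proof (rule negligible_subset)
    show "negligible ((vec_of_matrix \<circ> schur_map \<circ>
        matrix_of_vec) ` {x :: real^'n coords. critical (matrix_of_vec x)})"
      using schur_map_has_derivative real_det_critical(1) by (rule negligible_critical_image)
    show "C - \<psi> ` W \<subseteq> (vec_of_matrix \<circ> schur_map \<circ>
        matrix_of_vec) ` {x :: real^'n coords. critical (matrix_of_vec x)}"
    proof
      fix y :: "real^'n coords" assume y: "y \<in> C - \<psi> ` W"
      then have "condiagonalizable (matrix_of_vec y)" by (simp add: C_def)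
      then obtain Z where Z: "schur_map Z = matrix_of_vec y" "fundamental Z \<or> critical Z"
          by (rule condiagonalizable_schur_map)
      have "y = (vec_of_matrix \<circ> schur_map \<circ> matrix_of_vec) (vec_of_matrix Z)" using Z by simp
      moreover have "critical Z"
        using y Z(2) calculation by (auto simp: W_def \<psi>_def image_iff) (metis
            matrix_of_vec_vec_of_matrix)
      ultimately show "y \<in> (vec_of_matrix \<circ> schur_map \<circ>
          matrix_of_vec) ` {x. critical (matrix_of_vec x)}"
        by (metis (mono_tags, lifting) image_eqI mem_Collect_eq matrix_of_vec_vec_of_matrix)
    qed
  qed
  moreover have "\<psi> ` W \<subseteq> C"
    by (auto simp: \<psi>_def W_def C_def schur_map_condiagonalizable)
  then have "\<psi> ` W - C = {}" by blast
  ultimately have "integral C g = (1 / c) *\<^sub>R h 1"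
    by (subst integral_spike_set[of C "\<psi> ` W"]) (auto intro: negligible_subset[OF negpsi])
  moreover have "integral C g = h (integral C gauss)"
  proof -
    have "C \<in> sets borel"
    proof -
      have "(matrix_of_vec :: real^'n coords \<Rightarrow> _) \<in> borel_measurable borel"
        by (intro borel_measurable_continuous_onI linear_cont[OF linear_matrix_of_vec])
      from measurable_sets[OF this condiagonalizable_borel] show ?thesis by (simp add: C_def vimage_def)
    qed
    then have "gauss integrable_on C"
      using measure_gauss(1)[OF prob] set_lebesgue_integral_eq_integral(1) by blast
    then show ?thesis unfolding g_def using h by (rule integral_linear)
  qed
  ultimately have "integral C gauss = 1 / c" by (simp add: h_def vec_eq_iff)
  then show ?thesis by (simp only: c_def powr_minus_divide)
qed

theorem theorem3p1:
  fixes P :: "'a measure" and M :: "'a \<Rightarrow> complex^'n^'n"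
  assumes "prob_space P"
    and "prob_space.indep_vars P (\<lambda>_. borel)
           (\<lambda>(i, j, re) \<omega>. if re then Re (M \<omega> $ i $ j) else Im (M \<omega> $ i $ j))
           (UNIV :: ('n \<times> 'n \<times> bool) set)"
    and "\<And>i j. distributed P lborel (\<lambda>\<omega>. Re (M \<omega> $ i $ j)) std_normal_density"
    and "\<And>i j. distributed P lborel (\<lambda>\<omega>. Im (M \<omega> $ i $ j)) std_normal_density"
  shows "measure P {\<omega> \<in> space P. condiagonalizable (M \<omega>)} =
           2 powr (- (real CARD('n) * (real CARD('n) - 1) / 2))"
proof -
  define C where "C = {x :: real^'n coords. condiagonalizable (matrix_of_vec x)}"
  note law = gaussian_law[OF assms]
  \<comment> \<open>The normalization of \<open>gauss\<close> is inherited from the probability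
    space \<open>P\<close>.\<close>
  have prob: "prob_space (density lborel (\<lambda>x :: real^'n coords. ennreal (gauss x)))"
    using prob_space.prob_space_distr[OF assms(1) law(1)] law(2) by simp
  have C: "C \<in> sets borel"
  proof -
    have "(matrix_of_vec :: real^'n coords \<Rightarrow> _) \<in> borel_measurable borel"
      by (intro borel_measurable_continuous_onI linear_cont[OF linear_matrix_of_vec])
    from measurable_sets[OF this condiagonalizable_borel] show ?thesis by (simp add: C_def vimage_def)
  qed
  have "{\<omega> \<in> space P. condiagonalizable (M \<omega>)} = (\<lambda>\<omega>. vec_of_matrix (M \<omega>)) -` C \<inter> space P"
    by (auto simp: C_def)
  then have "measure P {\<omega> \<in> space P. condiagonalizable (M \<omega>)} =
      measure (distr P borel (\<lambda>\<omega>. vec_of_matrix (M \<omega>))) C"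
    using measure_distr[OF law(1) C] by simp
  also have "\<dots> = integral C gauss"
    unfolding law(2) by (rule measure_gauss(2)[OF prob C])
  also have "\<dots> = 2 powr (- (real CARD('n) * (real CARD('n) - 1) / 2))"
    unfolding C_def by (rule gauss_condiagonalizable[OF prob])
  finally show ?thesis .
qed

end
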